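(* Let $(X,d)$ be a locally complete metric space and let $\Phi,\Psi$ be time dependent arc fields on $X$, each satisfying Conditions A, B and C, and together satisfying Condition D (all written out in the context). Then for every $a\in X$ and $t\in[0,\infty)$ there exist $c>0$ and a solution curve $\sigma:[t,t+c)\to X$ of the sum of $\Phi$ and $\Psi$ with initial position $a$ at time $t$; that is, $\sigma(t)=a$ and for every $s\in[t,t+c)$ $$\lim_{h\to0^+}\frac{d\big(\sigma(s+2h),\Psi^{s+h}_{2h}\circ\Phi^{s}_{2h}(\sigma(s))\big)}{2h}=0 .$$
   Context: Locally complete means that every point of $X$ has a neighbourhood that is complete in the induced metric. $B(x,r)$ is the open ball of radius $r$ about $x$. Time dependent arc field: a map $\Phi:[0,\infty)\times X\times[0,1]\to X$, written $\Phi^t_h(x):=\Phi(t;x,h)$, such that for all $t\in[0,\infty)$, $x\in X$: $\Phi(t;x,0)=x$, $\rho(x,t):=\sup_{h\ne k}\frac{d(\Phi(t;x,h),\Phi(t;x,k))}{|h-k|}<\infty$, and $\rho$ is locally bounded, i.e. for all $(x,t)$ there exist $r,l>0$ such that $\rho(x,t;r,l):=\sup\{\rho(y,s): y\in B(x,r),\ s\ge 0,\ |t-s|\le l\}<\infty$. Condition A (for $\Phi$): There is a function $\Lambda:X\times X\times[0,1]\to(-\infty,\infty)$ such that for each $a\in X$ and $t\in[0,\infty)$ there are constants $r_a>0$, $\epsilon_a\in(0,1]$ and $T_t>t$ such that $\Lambda$ is bounded above on $B(a,r_a)\times B(a,r_a)\times[0,\epsilon_a]$ and $$d(\Phi^s_h(a_1),\Phi^s_h(a_2))\le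 d(a_1,a_2)\,(1+h\Lambda(a_1,a_2,h))$$ for all $a_1,a_2\in B(a,r_a)$, $h\in[0,\epsilon_a]$, $s\in[t,T_t]$. Condition B (for $\Phi$): There is a function $\Omega:X\times[0,1]\times[0,1]\to[0,\infty)$ such that for each $a\in X$ and $t\in[0,\infty)$ there are constants $r_a>0$, $\epsilon_a\in(0,1]$ and $T_t>t$ for which $\Omega$ is bounded on $B(a,r_a)\times[0,\epsilon_a]\times[0,\epsilon_a]$ and $$d(\Phi^s_{l+h}(b),\Phi^s_h\circ\Phi^s_l(b))\le h\,g(l,h)\,\Omega(b,l,h)$$ for all $b\in B(a,r_a)$, $l,h\in[0,\epsilon_a]$ (with $l+h\le 1$), $s\in[t,T_t]$, where $g:[0,\epsilon_a]\times[0,\epsilon_a]\to[0,\infty)$ satisfies $\lim_{l,h\to0^+}g(l,h)=0$ and $\sum_{i\in\mathbb{Z}^+,\,2^{-i}\le\epsilon_a}g(2^{-i},2^{-i})<\infty$. Condition C (for $\Phi$): For each $a\in X$ and $t\in[0,\infty)$ there are constants $r_a>0$, $\epsilon_a\in(0,1]$, $T_t>t$, $0<\alpha<1$ and $C>0$ such that $$d(\Phi^{s_1}_h(b),\Phi^{s_2}_h(b))\le C\,h\,|s_1-s_2|^\alpha$$ for all $b\in B(a,r_a)$, $h\in[0,\epsilon_a]$, $s_1,s_2\in[t,T_t]$. Condition D (for the pair $\Phi,\Psi$): There exist constants $0<\alpha<1$ and $C_d>0$ and a function $\Pi:X\times X\times[0,1]\to\mathbb{R}$ such that for each $a\in X$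 and $t\in[0,\infty)$ there are constants $r_a>0$, $\epsilon_a\in(0,1]$ and $T_t>t$ such that $\Pi$ is bounded from above on $B(a,r_a)\times B(a,r_a)\times[0,\epsilon_a]$ and $$d\big(\Phi^{s+h}_{2h}\circ\Psi^s_{2h}(b_1),\Psi^{s+h}_{2h}\circ\Phi^s_{2h}(b_2)\big)\le d(b_1,b_2)\,(1+h\Pi(b_1,b_2,h))+C_d\,h^{1+\alpha}$$ for all $b_1,b_2\in B(a,r_a)$, $h\in[0,\epsilon_a]$ (with $2h\le1$) and $s,s+h\in[t,T_t]$. *)

theory Defs
  imports "HOL-Analysis.Analysis"
begin

text \<open>
  An arc field is a total function \<open>\<Phi> t x h\<close> (written \<open>\<Phi>\<close> with upper index \<open>t\<close> and lower index
  \<open>h\<close>, applied to \<open>x\<close>). Only its values for \<open>t \<ge> 0\<close> and \<open>h \<in> {0..1}\<close> are meaningful, and every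
  condition below is restricted to that range. The same convention applies to the auxiliary
  functions \<open>\<Lambda>\<close>, \<open>\<Omega>\<close>, \<open>P\<close> and \<open>g\<close> and to solution curves.
\<close>

type_synonym 'a arc_map = "real \<Rightarrow> 'a \<Rightarrow> real \<Rightarrow> 'a"

text \<open>The suprema are taken in the extended reals, so that finiteness is a genuine condition.\<close>

definition arc_speed :: "('a::metric_space) arc_map \<Rightarrow> 'a \<Rightarrow> real \<Rightarrow> ereal" where
  "arc_speed \<Phi> x t =
     (SUP (h, k) \<in> {(h, k). h \<in> {0..1} \<and> k \<in> {0..1} \<and> h \<noteq> k}.
        ereal (dist (\<Phi> t x h) (\<Phi> t x k) / \<bar>h - k\<bar>))"

definition local_arc_speed ::
    "('a::metric_space) arc_map \<Rightarrow> 'a \<Rightarrow> real \<Rightarrow> real \<Rightarrow> real \<Rightarrow> ereal" where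
  "local_arc_speed \<Phi> x t r l =
     (SUP (y, s) \<in> {(y, s). y \<in> ball x r \<and> s \<ge> 0 \<and> \<bar>t - s\<bar> \<le> l}. arc_speed \<Phi> y s)"

definition time_dependent_arc_field :: "('a::metric_space) arc_map \<Rightarrow> bool" where
  "time_dependent_arc_field \<Phi> \<longleftrightarrow>
     (\<forall>t\<ge>0. \<forall>x. \<Phi> t x 0 = x \<and> arc_speed \<Phi> x t < \<infinity> \<and>
        (\<exists>r>0. \<exists>l>0. local_arc_speed \<Phi> x t r l < \<infinity>))"

definition condition_A :: "('a::metric_space) arc_map \<Rightarrow> bool" where
  "condition_A \<Phi> \<longleftrightarrow>
     (\<exists>\<Lambda> :: 'a \<Rightarrow> 'a \<Rightarrow> real \<Rightarrow> real.
        \<forall>a. \<forall>t\<ge>0. \<exists>r>0. \<exists>\<epsilon>\<in>{0<..1}. \<exists>T>t.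
          bdd_above ((\<lambda>(x, y, h). \<Lambda> x y h) ` (ball a r \<times> ball a r \<times> {0..\<epsilon>})) \<and>
          (\<forall>a1\<in>ball a r. \<forall>a2\<in>ball a r. \<forall>h\<in>{0..\<epsilon>}. \<forall>s\<in>{t..T}.
             dist (\<Phi> s a1 h) (\<Phi> s a2 h) \<le> dist a1 a2 * (1 + h * \<Lambda> a1 a2 h)))"

definition condition_B :: "('a::metric_space) arc_map \<Rightarrow> bool" where
  "condition_B \<Phi> \<longleftrightarrow>
     (\<exists>\<Omega> :: 'a \<Rightarrow> real \<Rightarrow> real \<Rightarrow> real.
        (\<forall>b. \<forall>l\<in>{0..1}. \<forall>h\<in>{0..1}. \<Omega> b l h \<ge> 0) \<and>
        (\<forall>a. \<forall>t\<ge>0. \<exists>r>0. \<exists>\<epsilon>\<in>{0<..1}. \<exists>T>t.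
           bounded ((\<lambda>(b, l, h). \<Omega> b l h) ` (ball a r \<times> {0..\<epsilon>} \<times> {0..\<epsilon>})) \<and>
           (\<exists>g :: real \<Rightarrow> real \<Rightarrow> real.
              (\<forall>l\<in>{0..\<epsilon>}. \<forall>h\<in>{0..\<epsilon>}. g l h \<ge> 0) \<and>
              ((\<lambda>(l, h). g l h) \<longlongrightarrow> 0) (at_right 0 \<times>\<^sub>F at_right 0) \<and>
              (\<lambda>i. g ((1/2) ^ i) ((1/2) ^ i)) summable_on {i::nat. i \<ge> 1 \<and> (1/2) ^ i \<le> \<epsilon>} \<and>
              (\<forall>b\<in>ball a r. \<forall>l\<in>{0..\<epsilon>}. \<forall>h\<in>{0..\<epsilon>}. \<forall>s\<in>{t..T}. l + h \<le> 1 \<longrightarrow>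
                 dist (\<Phi> s b (l + h)) (\<Phi> s (\<Phi> s b l) h) \<le> h * g l h * \<Omega> b l h))))"

definition condition_C :: "('a::metric_space) arc_map \<Rightarrow> bool" where
  "condition_C \<Phi> \<longleftrightarrow>
     (\<forall>a. \<forall>t\<ge>0. \<exists>r>0. \<exists>\<epsilon>\<in>{0<..1}. \<exists>T>t. \<exists>\<alpha>\<in>{0<..<1}. \<exists>C>0.
        \<forall>b\<in>ball a r. \<forall>h\<in>{0..\<epsilon>}. \<forall>s1\<in>{t..T}. \<forall>s2\<in>{t..T}.
          dist (\<Phi> s1 b h) (\<Phi> s2 b h) \<le> C * h * \<bar>s1 - s2\<bar> powr \<alpha>)"

definition condition_D :: "('a::metric_space) arc_map \<Rightarrow> 'a arc_map \<Rightarrow> bool" where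
  "condition_D \<Phi> \<Psi> \<longleftrightarrow>
     (\<exists>\<alpha>\<in>{0<..<1}. \<exists>C>0. \<exists>P :: 'a \<Rightarrow> 'a \<Rightarrow> real \<Rightarrow> real.
        \<forall>a. \<forall>t\<ge>0. \<exists>r>0. \<exists>\<epsilon>\<in>{0<..1}. \<exists>T>t.
          bdd_above ((\<lambda>(x, y, h). P x y h) ` (ball a r \<times> ball a r \<times> {0..\<epsilon>})) \<and>
          (\<forall>b1\<in>ball a r. \<forall>b2\<in>ball a r. \<forall>h\<in>{0..\<epsilon>}. \<forall>s\<in>{t..T}.
             2 * h \<le> 1 \<and> s + h \<in> {t..T} \<longrightarrow>
             dist (\<Phi> (s + h) (\<Psi> s b1 (2 * h)) (2 * h)) (\<Psi> (s + h) (\<Phi> s b2 (2 * h)) (2 * h))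
               \<le> dist b1 b2 * (1 + h * P b1 b2 h) + C * h powr (1 + \<alpha>)))"

text \<open>
  Only the values of \<open>\<sigma>\<close> on \<open>{t..<t + c}\<close> matter: for \<open>s\<close> in this interval, \<open>s + 2 * h\<close> also
  lies in it for all small \<open>h > 0\<close>.
\<close>

definition sum_solution_curve ::
    "('a::metric_space) arc_map \<Rightarrow> 'a arc_map \<Rightarrow> 'a \<Rightarrow> real \<Rightarrow> real \<Rightarrow> (real \<Rightarrow> 'a) \<Rightarrow> bool" where
  "sum_solution_curve \<Phi> \<Psi> a t c \<sigma> \<longleftrightarrow>
     \<sigma> t = a \<and>
     (\<forall>s\<in>{t..<t + c}.
        ((\<lambda>h. dist (\<sigma> (s + 2 * h)) (\<Psi> (s + h) (\<Phi> s (\<sigma> s) (2 * h)) (2 * h)) / (2 * h))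
           \<longlongrightarrow> 0) (at_right 0))"

end

theory Submission imports Defs begin

text \<open>
  The solution is the limit of Euler polygons of mesh \<open>(1/2)^n\<close> for the one-step map
  \<open>G s \<tau> x = \<Psi> (s + \<tau> / 2) (\<Phi> s x \<tau>) \<tau>\<close>. Halving one step splits both arc fields (condition B),
  adjusts their clocks (condition C) and exchanges the two middle moves (condition D), at a total
  cost of \<open>\<tau>\<close> times a term that is summable over the dyadic step sizes; the Lipschitz bound of
  condition A propagates this cost. Hence the polygons converge, to a Lipschitz curve \<open>\<sigma>\<close>.

  The summability in B is only available along dyadic steps, whereas tangency is required for every
  small \<open>h\<close>. Choose \<open>n\<close> such that \<open>h\<close> is roughly \<open>N\<close> dyadic steps with \<open>N\<close> in a fixed range
  \<open>{N0..2 * N0}\<close>; the rounding errors are \<open>O(h / N0)\<close>. For fixed \<open>N\<close>, one step of length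
  \<open>N * \<tau>\<close> agrees with \<open>N\<close> steps of length \<open>\<tau>\<close> up to \<open>o(\<tau>)\<close>: condition B peels off one step at a time
  and, by induction on \<open>N\<close>, condition D lets a move of length \<open>\<tau>\<close> along \<open>\<Phi>\<close> be exchanged with one of length
  \<open>N * \<tau>\<close> along \<open>\<Psi>\<close>.
\<close>

subsection \<open>Convergence of Euler polygons\<close>

text \<open>The order of choices in the tangency argument avoids any uniformity in \<open>N\<close>:
  the tolerance fixes \<open>N0\<close>, and only then is the admissible scale taken as a minimum
  over the finitely many \<open>N\<close> up to \<open>2 * N0\<close>. So first-order agreement for
  each separate \<open>N\<close> is enough, and this relation is compatible with composition, which
  turns the exchange of moves into algebra with words in the two arc fields. The exchange is needed
  in two precisions: with an explicit bound at the mesh sizes \<open>(1/2)^i\<close> for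
  convergence, and as o(\<tau>) at all small \<tau> for tangency. The half-step clock of the second
  move obstructs both: a step of length \<open>2 * \<tau>\<close> runs the fields at the times s and
  s + \<tau>, while two steps of length \<tau> run them at s, s + \<tau>/2, s + \<tau> and s +
  3\<tau>/2. Each clock correction costs a multiple of \<open>\<tau> powr (1 + \<alpha>)\<close>,
  which is o(\<tau>) and, after division by \<tau>, geometric along the dyadic steps. The local
  bounds hold only on an interval of times that starts at \<open>t\<close>, so neighbourhoods in
  time are one-sided.\<close>

lemma one_plus_le_exp_mult:
  fixes b e :: real
  assumes "0 \<le> b" shows "(1 + b) * exp e \<le> exp (b + e)"
  using exp_ge_add_one_self[of b] by (simp add: exp_add)

lemma Cauchy_if_summable_steps:
  fixes f :: "nat \<Rightarrow> 'b::metric_space"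
  assumes "\<And>n. dist (f n) (f (Suc n)) \<le> b n" "summable b"
  shows "Cauchy f"
proof (rule CauchyI')
  fix e :: real assume "0 < e"
  have b: "0 \<le> b n" for n using assms(1)[of n] zero_le_dist order_trans by blast
  obtain M where M: "\<And>n. n \<ge> M \<Longrightarrow> norm (\<Sum>i. b (i + n)) < e"
    using suminf_exist_split[OF \<open>0 < e\<close> assms(2)] by blast
  have "dist (f m) (f (m + k)) \<le> (\<Sum>i<k. b (i + m))" for m k
  proof (induction k)
    case (Suc k)
    then show ?case using assms(1)[of "m + k"] dist_triangle[of "f m" "f (m + Suc k)" "f (m + k)"]
      by (simp add: add.commute)
  qed simp
  moreover have "(\<Sum>i<k. b (i + m)) \<le> (\<Sum>i. b (i + m))" for m k
    by (intro sum_le_suminf) (auto simp: b summable_iff_shift assms(2))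
  ultimately have le: "dist (f m) (f (m + k)) \<le> (\<Sum>i. b (i + m))" for m k
    using order_trans by blast
  have "dist (f m) (f (m + k)) < e" if "m \<ge> M" for m k
    using M[OF that] le[of m k] by simp
  then have "dist (f m) (f n) < e" if "m \<ge> M" "n > m" for m n
    using that by (metis le_add_diff_inverse less_imp_le)
  then show "\<exists>M. \<forall>m\<ge>M. \<forall>n>m. dist (f m) (f n) < e" by blast
qed

text \<open>The least such exponent gives the factor 2. With \<open>b\<close> a natural number
  \<open>N0\<close>, it places \<open>h\<close> between \<open>N0\<close> and \<open>2 * N0\<close>
  dyadic steps, so the number of steps stays bounded while the mesh shrinks with
  \<open>h\<close>.\<close>

lemma dyadic_scale:
  fixes h b :: real
  assumes "0 < h" "h < b"
  obtains n where "b * (1/2)^n \<le> h" "h < 2 * (b * (1/2)^n)"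
proof -
  have "\<exists>n. b * (1/2)^n \<le> h"
  proof -
    obtain n where "(1/2)^n < h / b" using real_arch_pow_inv[of "h / b" "1/2"] assms by auto
    then show ?thesis using assms by (intro exI[of _ n]) (simp add: field_simps)
  qed
  then obtain n where n: "b * (1/2)^n \<le> h" "\<And>m. m < n \<Longrightarrow> \<not> b * (1/2)^m \<le> h"
    using exists_least_iff[of "\<lambda>n. b * (1/2)^n \<le> h"] by blast
  have "n \<noteq> 0" using n(1) assms by (cases "n = 0") auto
  then have "h < 2 * (b * (1/2)^n)" using n(2)[of "n - 1"] by (cases n) auto
  with n(1) show ?thesis using that by blast
qed

primrec euler :: "(real \<Rightarrow> real \<Rightarrow> 'a \<Rightarrow> 'a) \<Rightarrow> real \<Rightarrow> real \<Rightarrow> 'a \<Rightarrow> nat \<Rightarrow> 'a" where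
  "euler G \<tau> s x 0 = x"
| "euler G \<tau> s x (Suc k) = G (s + real k * \<tau>) \<tau> (euler G \<tau> s x k)"

lemma euler_add:
  "euler G \<tau> s x (j + k) = euler G \<tau> (s + real j * \<tau>) (euler G \<tau> s x j) k"
  by (induction k) (simp_all add: algebra_simps)

text \<open>What the limit argument asks of a one-step map, without mention of arc fields.
  \<open>defect\<close> is quantitative but restricted to dyadic steps; \<open>consistent\<close> is
  qualitative but covers all small steps for each fixed \<open>N\<close>. The first drives
  convergence, and tangency takes both. \<open>consistent\<close> looks only at times from
  \<open>s0\<close> on, since \<open>s0\<close> may be the left endpoint \<open>t\<close>.\<close>

locale evolution_scheme =
  fixes G :: "real \<Rightarrow> real \<Rightarrow> 'a::metric_space \<Rightarrow> 'a"
    and a :: 'a and t \<delta> L K :: real and w :: "nat \<Rightarrow> real" and U :: "'a set"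
  assumes \<delta>: "0 < \<delta>" and L: "0 \<le> L" and K: "0 \<le> K"
    and w: "\<And>i. 0 \<le> w i" "summable w"
    and U: "complete U" "ball a \<delta> \<subseteq> U"
    and move: "\<And>s x \<tau>. \<lbrakk>s \<in> {t..t+\<delta>}; x \<in> ball a \<delta>; \<tau> \<in> {0..\<delta>}\<rbrakk> \<Longrightarrow> dist x (G s \<tau> x) \<le> L * \<tau>"
    and lip: "\<And>s x y \<tau>. \<lbrakk>s \<in> {t..t+\<delta>}; x \<in> ball a \<delta>; y \<in> ball a \<delta>; \<tau> \<in> {0..\<delta>}\<rbrakk>
                \<Longrightarrow> dist (G s \<tau> x) (G s \<tau> y) \<le> (1 + K * \<tau>) * dist x y"
    and defect: "\<And>s x i. \<lbrakk>s \<in> {t..t+\<delta>}; x \<in> ball a \<delta>; (1/2)^i \<le> \<delta>\<rbrakk>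
                \<Longrightarrow> dist (G s (2 * (1/2)^i) x) (G (s + (1/2)^i) ((1/2)^i) (G s ((1/2)^i) x))
                      \<le> (1/2)^i * w i"
    and consistent: "\<And>s0 p N e. \<lbrakk>s0 \<in> {t..<t+\<delta>}; p \<in> ball a \<delta>; 0 < e\<rbrakk>
                \<Longrightarrow> \<exists>\<eta>>0. \<forall>\<tau>\<in>{0<..<\<eta>}. \<forall>s\<in>{s0..<s0+\<eta>}. \<forall>x\<in>ball p \<eta>.
                       dist (G s (real N * \<tau>) x) (euler G \<tau> s x N) \<le> e * \<tau>"
    and regular: "\<And>e. 0 < e \<Longrightarrow> \<exists>\<eta>>0. \<forall>s\<in>{t..t+\<delta>}. \<forall>s'\<in>{t..t+\<delta>}. \<forall>\<tau>\<in>{0..\<delta>}. \<forall>\<tau>'\<in>{0..\<delta>}.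
                \<forall>x\<in>ball a \<delta>. \<bar>s - s'\<bar> \<le> \<eta> \<longrightarrow> \<bar>\<tau> - \<tau>'\<bar> \<le> \<eta> \<longrightarrow>
                dist (G s \<tau> x) (G s' \<tau>' x) \<le> L * \<bar>\<tau> - \<tau>'\<bar> + e * \<tau>"
begin

text \<open>The \<open>+ 1\<close> makes \<open>L * c < \<delta>\<close> strict even for
  \<open>L = 0\<close>, so a curve of speed \<open>L\<close> stays in the open ball up to and
  including time \<open>t + c\<close>.\<close>

definition c :: real where "c = \<delta> / (L + 1)"

lemma c: "0 < c" "c \<le> \<delta>" "L * c < \<delta>"
  using \<delta> L by (auto simp: c_def field_simps)

text \<open>A scheme of speed \<open>L\<close> started at \<open>a\<close> never leaves this cone, so no iterate can escape the ball.\<close>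
definition cone :: "real \<Rightarrow> 'a \<Rightarrow> bool" where
  "cone s x \<longleftrightarrow> s \<in> {t..t+c} \<and> dist a x \<le> L * (s - t)"

lemma cone_ball: assumes "cone s x" shows "x \<in> ball a \<delta>" "s \<in> {t..t+\<delta>}"
proof -
  have "L * (s - t) \<le> L * c" using assms L by (auto simp: cone_def intro!: mult_left_mono)
  then show "x \<in> ball a \<delta>" "s \<in> {t..t+\<delta>}" using assms c by (auto simp: cone_def)
qed

lemma cone_start: "cone t a"
  using c by (simp add: cone_def)

lemma cone_step:
  assumes "cone s x" "0 \<le> \<tau>" "s + \<tau> \<le> t + c"
  shows "cone (s + \<tau>) (G s \<tau> x)"
proof -
  have "\<tau> \<in> {0..\<delta>}" using assms c by (auto simp: cone_def)
  then have "dist x (G s \<tau> x) \<le> L * \<tau>" using move cone_ball[OF assms(1)] by blast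
  moreover have "dist a x \<le> L * (s - t)" using assms by (simp add: cone_def)
  ultimately have "dist a (G s \<tau> x) \<le> L * (s - t) + L * \<tau>"
    using dist_triangle[of a "G s \<tau> x" x] by linarith
  then show ?thesis using assms by (auto simp: cone_def algebra_simps)
qed

lemma cone_euler:
  assumes "cone s x" "0 \<le> \<tau>" "s + real k * \<tau> \<le> t + c"
  shows "cone (s + real k * \<tau>) (euler G \<tau> s x k)" "dist x (euler G \<tau> s x k) \<le> L * (real k * \<tau>)"
proof -
  have "cone (s + real k * \<tau>) (euler G \<tau> s x k) \<and> dist x (euler G \<tau> s x k) \<le> L * (real k * \<tau>)"
    using assms(3)
  proof (induction k)
    case 0
    then show ?case using assms by simp
  next
    case (Suc k)
    have le: "s + real k * \<tau> + \<tau> \<le> t + c" using Suc.prems by (simp add: algebra_simps)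
    with assms(2) have IH: "cone (s + real k * \<tau>) (euler G \<tau> s x k)"
      "dist x (euler G \<tau> s x k) \<le> L * (real k * \<tau>)" using Suc.IH by auto
    have 1: "cone (s + real k * \<tau> + \<tau>) (euler G \<tau> s x (Suc k))"
      using cone_step[OF IH(1) assms(2) le] by simp
    have "\<tau> \<in> {0..\<delta>}" using le IH(1) assms c by (auto simp: cone_def)
    then have "dist (euler G \<tau> s x k) (euler G \<tau> s x (Suc k)) \<le> L * \<tau>"
      using move cone_ball[OF IH(1)] by simp
    then have "dist x (euler G \<tau> s x (Suc k)) \<le> L * (real k * \<tau>) + L * \<tau>"
      using IH(2) dist_triangle[of x "euler G \<tau> s x (Suc k)" "euler G \<tau> s x k"] by linarith
    with 1 show ?case by (simp add: algebra_simps)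
  qed
  then show "cone (s + real k * \<tau>) (euler G \<tau> s x k)" "dist x (euler G \<tau> s x k) \<le> L * (real k * \<tau>)"
    by auto
qed

section \<open>Stability of Euler iterates and the cost of halving the mesh\<close>

lemma euler_lipschitz:
  assumes "cone s x" "cone s y" "0 \<le> \<tau>" "s + real k * \<tau> \<le> t + c"
  shows "dist (euler G \<tau> s x k) (euler G \<tau> s y k) \<le> exp (K * (real k * \<tau>)) * dist x y"
  using assms(4)
proof (induction k)
  case (Suc k)
  have le: "s + real k * \<tau> + \<tau> \<le> t + c" using Suc.prems by (simp add: algebra_simps)
  then have IH: "dist (euler G \<tau> s x k) (euler G \<tau> s y k) \<le> exp (K * (real k * \<tau>)) * dist x y"
    using Suc.IH assms(3) by simp
  have k: "s + real k * \<tau> \<le> t + c" using le assms(3) by simp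
  note cx = cone_euler(1)[OF assms(1,3) k] and cy = cone_euler(1)[OF assms(2,3) k]
  have "\<tau> \<in> {0..\<delta>}" using le cx assms c by (auto simp: cone_def)
  then have "dist (euler G \<tau> s x (Suc k)) (euler G \<tau> s y (Suc k))
      \<le> (1 + K * \<tau>) * dist (euler G \<tau> s x k) (euler G \<tau> s y k)"
    using lip cone_ball[OF cx] cone_ball[OF cy] by simp
  also have "\<dots> \<le> (1 + K * \<tau>) * (exp (K * (real k * \<tau>)) * dist x y)"
    using IH K assms(3) by (intro mult_left_mono) auto
  also have "\<dots> = (1 + K * \<tau>) * exp (K * (real k * \<tau>)) * dist x y" by simp
  also have "\<dots> \<le> exp (K * \<tau> + K * (real k * \<tau>)) * dist x y"
    using K assms(3) by (intro mult_right_mono one_plus_le_exp_mult) auto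
  finally show ?case by (simp add: algebra_simps)
qed simp

text \<open>A discrete Gronwall argument: a coarse step of length \<open>2 * \<tau>\<close>
  stretches the distance of the two iterates by at most \<open>1 + K * (2 * \<tau>)\<close>, and
  replacing it by two fine ones adds \<open>\<tau> * w (Suc n)\<close>. The defect is measured at
  the fine iterate, so only the coarse map has to be applied to two different points.\<close>

lemma euler_refine:
  assumes "cone s x" "s + real k * (1/2)^n \<le> t + c"
  shows "dist (euler G ((1/2)^n) s x k) (euler G ((1/2)^Suc n) s x (2 * k))
     \<le> exp (K * (real k * (1/2)^n)) * (real k * (1/2)^Suc n) * w (Suc n)"
  using assms(2)
proof (induction k)
  case (Suc k)
  define \<tau> :: real where "\<tau> = (1/2)^Suc n"
  have \<tau>: "0 < \<tau>" "(1/2)^n = 2 * \<tau>" by (auto simp: \<tau>_def)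
  let ?u = "euler G (2*\<tau>) s x k" and ?v = "euler G \<tau> s x (2*k)"
  let ?s = "s + real k * (2*\<tau>)"
  have le: "?s + 2*\<tau> \<le> t + c" using Suc.prems by (simp add: \<tau>(2) algebra_simps)
  then have k: "?s \<le> t + c" using \<tau> by simp
  then have IH: "dist ?u ?v \<le> exp (K * (real k * (2*\<tau>))) * (real k * \<tau>) * w (Suc n)"
    using Suc.IH by (simp add: \<tau>(2) \<tau>_def[symmetric] del: power_Suc)
  have cu: "cone ?s ?u" using cone_euler(1)[OF assms(1) _ k] \<tau> by simp
  have cv: "cone ?s ?v" using cone_euler(1)[OF assms(1), of \<tau> "2*k"] k \<tau> by (simp add: algebra_simps)
  have d: "2*\<tau> \<in> {0..\<delta>}" using le cu \<tau> c by (auto simp: cone_def)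
  have "dist (euler G (2*\<tau>) s x (Suc k)) (G ?s (2*\<tau>) ?v) \<le> (1 + K * (2*\<tau>)) * dist ?u ?v"
    using lip[OF cone_ball(2)[OF cu] cone_ball(1)[OF cu] cone_ball(1)[OF cv] d] by simp
  moreover have "dist (G ?s (2*\<tau>) ?v) (euler G \<tau> s x (2 * Suc k)) \<le> \<tau> * w (Suc n)"
    using defect[OF cone_ball(2)[OF cv] cone_ball(1)[OF cv], of "Suc n"] d \<tau>
    unfolding \<tau>_def[symmetric] by (simp add: algebra_simps)
  ultimately have "dist (euler G (2*\<tau>) s x (Suc k)) (euler G \<tau> s x (2 * Suc k))
      \<le> (1 + K * (2*\<tau>)) * dist ?u ?v + \<tau> * w (Suc n)"
    using dist_triangle[of "euler G (2*\<tau>) s x (Suc k)" "euler G \<tau> s x (2 * Suc k)" "G ?s (2*\<tau>) ?v"]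
    by linarith
  also have "(1 + K * (2*\<tau>)) * dist ?u ?v
      \<le> (1 + K * (2*\<tau>)) * (exp (K * (real k * (2*\<tau>))) * (real k * \<tau>) * w (Suc n))"
    using IH K \<tau> by (intro mult_left_mono) auto
  also have "\<dots> = ((1 + K * (2*\<tau>)) * exp (K * (real k * (2*\<tau>)))) * (real k * \<tau> * w (Suc n))"
    by simp
  also have "\<dots> \<le> exp (K * (2*\<tau>) + K * (real k * (2*\<tau>))) * (real k * \<tau> * w (Suc n))"
    using K \<tau> w by (intro mult_right_mono one_plus_le_exp_mult) auto
  also have "K * (2*\<tau>) + K * (real k * (2*\<tau>)) = K * (real (Suc k) * (2*\<tau>))"
    by (simp add: algebra_simps)
  also have "\<tau> * w (Suc n) \<le> exp (K * (real (Suc k) * (2*\<tau>))) * (\<tau> * w (Suc n))"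
    using mult_right_mono[of 1 "exp (K * (real (Suc k) * (2*\<tau>)))" "\<tau> * w (Suc n)"] K \<tau>(1) w(1)[of "Suc n"]
    by simp
  finally have "dist (euler G (2*\<tau>) s x (Suc k)) (euler G \<tau> s x (2 * Suc k))
    \<le> exp (K * (real (Suc k) * (2*\<tau>))) * (real k * \<tau> * w (Suc n))
      + exp (K * (real (Suc k) * (2*\<tau>))) * (\<tau> * w (Suc n))" by simp
  also have "\<dots> = exp (K * (real (Suc k) * (2*\<tau>))) * (real (Suc k) * \<tau>) * w (Suc n)"
    by (simp add: algebra_simps)
  finally show ?case unfolding \<tau>(2) \<tau>_def[symmetric] .
qed simp

text \<open>A factor 2 is given away so that the bound contains the elapsed time
  \<open>real k * (1/2)^n\<close>, which does not change when \<open>k\<close> is doubled and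
  \<open>n\<close> raised by one. The costs of successive halvings then add up to a sum over
  \<open>w\<close>.\<close>

lemma euler_refine_le:
  assumes "cone s x" "s + real k * (1/2)^n \<le> t + c"
  shows "dist (euler G ((1/2)^n) s x k) (euler G ((1/2)^Suc n) s x (2 * k))
     \<le> exp (K * c) * (real k * (1/2)^n) * w (Suc n)"
proof -
  have "real k * (1/2)^n \<le> c" using assms by (auto simp: cone_def)
  then have "exp (K * (real k * (1/2)^n)) \<le> exp (K * c)" using K by (simp add: mult_left_mono)
  then have "exp (K * (real k * (1/2)^n)) * (real k * (1/2)^Suc n) * w (Suc n)
      \<le> exp (K * c) * (real k * (1/2)^n) * w (Suc n)"
    using w by (intro mult_right_mono mult_mono) auto
  then show ?thesis using euler_refine[OF assms] by linarith
qed

lemma euler_refine_many: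
  assumes "cone s x" "s + real k * (1/2)^n \<le> t + c"
  shows "dist (euler G ((1/2)^n) s x k) (euler G ((1/2)^(n+m)) s x (k * 2^m))
     \<le> exp (K * c) * (real k * (1/2)^n) * (\<Sum>i<m. w (i + Suc n))"
proof (induction m)
  case (Suc m)
  have eq: "real (k * 2^m) * (1/2)^(n+m) = real k * (1/2)^n"
    by (simp add: power_add power_one_over)
  have "dist (euler G ((1/2)^(n+m)) s x (k * 2^m)) (euler G ((1/2)^Suc (n+m)) s x (2 * (k * 2^m)))
     \<le> exp (K * c) * (real k * (1/2)^n) * w (Suc (n+m))"
    using euler_refine_le[OF assms(1), of "k * 2^m" "n+m"] assms(2) unfolding eq by simp
  with Suc dist_triangle[of "euler G ((1/2)^n) s x k" "euler G ((1/2)^Suc (n+m)) s x (2 * (k * 2^m))"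
      "euler G ((1/2)^(n+m)) s x (k * 2^m)"]
  have "dist (euler G ((1/2)^n) s x k) (euler G ((1/2)^Suc (n+m)) s x (2 * (k * 2^m)))
    \<le> exp (K * c) * (real k * (1/2)^n) * (\<Sum>i<m. w (i + Suc n))
      + exp (K * c) * (real k * (1/2)^n) * w (Suc (n+m))" by linarith
  then show ?case by (simp add: algebra_simps)
qed simp

section \<open>Step functions through the Euler points and their limit curve\<close>

definition polygon :: "nat \<Rightarrow> real \<Rightarrow> 'a" where
  "polygon n s = euler G ((1/2)^n) t a (nat \<lfloor>(s - t) * 2^n\<rfloor>)"

lemma floor_grid:
  assumes "t \<le> s"
  shows "real (nat \<lfloor>(s - t) * 2^n\<rfloor>) * (1/2)^n \<le> s - t"
    "s - t < real (nat \<lfloor>(s - t) * 2^n\<rfloor>) * (1/2)^n + (1/2)^n"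
proof -
  have nn: "0 \<le> \<lfloor>(s - t) * 2^n\<rfloor>" using assms by simp
  then have eq: "real (nat \<lfloor>(s - t) * 2^n\<rfloor>) = of_int \<lfloor>(s - t) * 2^n\<rfloor>" by simp
  have "real (nat \<lfloor>(s - t) * 2^n\<rfloor>) \<le> (s - t) * 2^n" unfolding eq by simp
  then show "real (nat \<lfloor>(s - t) * 2^n\<rfloor>) * (1/2)^n \<le> s - t"
    by (simp add: power_one_over field_simps)
  have "(s - t) * 2^n < real (nat \<lfloor>(s - t) * 2^n\<rfloor>) + 1" unfolding eq by linarith
  then show "s - t < real (nat \<lfloor>(s - t) * 2^n\<rfloor>) * (1/2)^n + (1/2)^n"
    by (simp add: power_one_over field_simps)
qed

lemma polygon_cone:
  assumes "s \<in> {t..t+c}" shows "cone s (polygon n s)"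
proof -
  let ?k = "nat \<lfloor>(s - t) * 2^n\<rfloor>"
  have k: "t + real ?k * (1/2)^n \<le> s" using floor_grid(1)[of s n] assms by simp
  then have "dist a (polygon n s) \<le> L * (real ?k * (1/2)^n)"
    unfolding polygon_def using assms by (intro cone_euler(2) cone_start) auto
  also have "\<dots> \<le> L * (s - t)" using k L by (intro mult_left_mono) auto
  finally show ?thesis using assms by (simp add: cone_def)
qed

lemma euler_between:
  assumes "j \<le> k" "0 \<le> \<tau>" "t + real k * \<tau> \<le> t + c"
  shows "dist (euler G \<tau> t a j) (euler G \<tau> t a k) \<le> L * ((real k - real j) * \<tau>)"
proof -
  obtain i where i: "k = j + i" using assms(1) le_Suc_ex by blast
  have j: "t + real j * \<tau> \<le> t + c"
    using assms mult_right_mono[of "real j" "real k" \<tau>] by auto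
  have "dist (euler G \<tau> t a j) (euler G \<tau> (t + real j * \<tau>) (euler G \<tau> t a j) i) \<le> L * (real i * \<tau>)"
    using assms(3) by (intro cone_euler(2) cone_euler(1) cone_start assms(2) j)
      (simp add: i algebra_simps)
  then show ?thesis by (simp add: i euler_add)
qed

lemma polygon_step:
  assumes "s \<in> {t..t+c}"
  shows "dist (polygon n s) (polygon (Suc n) s) \<le> exp (K * c) * c * w (Suc n) + L * (1/2)^Suc n"
proof -
  define k where "k = nat \<lfloor>(s - t) * 2^n\<rfloor>"
  define k' where "k' = nat \<lfloor>(s - t) * 2^Suc n\<rfloor>"
  have k: "real k * (1/2)^n \<le> s - t" "s - t < real k * (1/2)^n + (1/2)^n"
    using floor_grid[of s n] assms by (auto simp: k_def)
  have k': "real k' * (1/2)^Suc n \<le> s - t" "s - t < real k' * (1/2)^Suc n + (1/2)^Suc n"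
    using floor_grid[of s "Suc n"] assms by (auto simp: k'_def)
  \<comment> \<open>The finer floor \<open>k'\<close> turns out to be \<open>2 * k\<close> or
    \<open>2 * k + 1\<close>, so at most one fine step separates the iterates; this is the term
    \<open>L * (1/2)^Suc n\<close>.\<close>
  have p: "(0::real) < (1/2)^Suc n" "(1/2::real)^n = 2 * (1/2)^Suc n" by auto
  have "real (2 * k) * (1/2)^Suc n < (real k' + 1) * (1/2)^Suc n"
    using k(1) k'(2) p(2) by (simp add: algebra_simps del: power_Suc)
  then have "real (2 * k) < real k' + 1" using p(1) mult_less_cancel_right_pos by blast
  then have 1: "2 * k \<le> k'" by linarith
  have "real k' * (1/2)^Suc n < (real (2 * k) + 2) * (1/2)^Suc n"
    using k'(1) k(2) p(2) by (simp add: algebra_simps del: power_Suc)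
  then have "real k' < real (2 * k) + 2" using p(1) mult_less_cancel_right_pos by blast
  then have 2: "k' \<le> 2 * k + 1" by linarith
  have "dist (euler G ((1/2)^n) t a k) (euler G ((1/2)^Suc n) t a (2 * k))
     \<le> exp (K * c) * (real k * (1/2)^n) * w (Suc n)"
    using euler_refine_le[OF cone_start] k(1) assms by auto
  also have "\<dots> \<le> exp (K * c) * c * w (Suc n)"
    using k(1) assms w by (intro mult_right_mono mult_left_mono) auto
  finally have 3: "dist (polygon n s) (euler G ((1/2)^Suc n) t a (2 * k)) \<le> exp (K * c) * c * w (Suc n)"
    unfolding polygon_def k_def .
  have "dist (euler G ((1/2)^Suc n) t a (2 * k)) (euler G ((1/2)^Suc n) t a k')
    \<le> L * ((real k' - real (2 * k)) * (1/2)^Suc n)"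
    using k'(1) assms by (intro euler_between 1) auto
  also have "\<dots> \<le> L * (1 * (1/2)^Suc n)"
    using 2 L by (intro mult_left_mono mult_right_mono) auto
  finally have "dist (euler G ((1/2)^Suc n) t a (2 * k)) (polygon (Suc n) s) \<le> L * (1/2)^Suc n"
    unfolding polygon_def k'_def by simp
  with 3 show ?thesis
    using dist_triangle[of "polygon n s" "polygon (Suc n) s" "euler G ((1/2)^Suc n) t a (2 * k)"] by linarith
qed

definition \<sigma> :: "real \<Rightarrow> 'a" where "\<sigma> s = lim (\<lambda>n. polygon n s)"

lemma polygon_tendsto:
  assumes "s \<in> {t..t+c}" shows "(\<lambda>n. polygon n s) \<longlonglongrightarrow> \<sigma> s"
proof -
  have "summable (\<lambda>n. exp (K * c) * c * w (Suc n) + L * (1/2)^Suc n)"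
    using w(2) by (intro summable_add summable_mult) (auto simp: summable_Suc_iff intro: summable_geometric)
  then have "Cauchy (\<lambda>n. polygon n s)"
    using polygon_step[OF assms] by (intro Cauchy_if_summable_steps)
  moreover have "polygon n s \<in> U" for n using polygon_cone[OF assms] cone_ball U by blast
  ultimately obtain l where "(\<lambda>n. polygon n s) \<longlonglongrightarrow> l" using U(1) by (metis completeE)
  then show ?thesis by (simp add: \<sigma>_def limI)
qed

lemma \<sigma>_start: "\<sigma> t = a"
  by (simp add: \<sigma>_def polygon_def)

lemma \<sigma>_cone:
  assumes "s \<in> {t..t+c}" shows "cone s (\<sigma> s)"
proof -
  have "(\<lambda>n. dist a (polygon n s)) \<longlonglongrightarrow> dist a (\<sigma> s)"
    using polygon_tendsto[OF assms] by (intro tendsto_intros)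
  then have "dist a (\<sigma> s) \<le> L * (s - t)"
    by (rule LIMSEQ_le_const2) (use polygon_cone[OF assms] in \<open>auto simp: cone_def\<close>)
  then show ?thesis using assms by (simp add: cone_def)
qed

lemma \<sigma>_lipschitz_aux:
  assumes "t \<le> s" "s \<le> s'" "s' \<le> t + c"
  shows "dist (\<sigma> s) (\<sigma> s') \<le> L * (s' - s)"
proof -
  have in_dom: "s \<in> {t..t+c}" "s' \<in> {t..t+c}" using assms by auto
  have "dist (polygon n s) (polygon n s') \<le> L * (s' - s + (1/2)^n)" for n
  proof -
    let ?k = "nat \<lfloor>(s - t) * 2^n\<rfloor>" and ?k' = "nat \<lfloor>(s' - t) * 2^n\<rfloor>"
    have "?k \<le> ?k'" using assms by (intro nat_mono floor_mono mult_right_mono) auto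
    then have "dist (polygon n s) (polygon n s') \<le> L * ((real ?k' - real ?k) * (1/2)^n)"
      unfolding polygon_def using floor_grid(1)[of s' n] assms by (intro euler_between) auto
    also have "\<dots> \<le> L * (s' - s + (1/2)^n)"
      using floor_grid[of s n] floor_grid[of s' n] assms L
      by (intro mult_left_mono) (auto simp: algebra_simps)
    finally show ?thesis .
  qed
  moreover have "(\<lambda>n. L * (s' - s + (1/2)^n)) \<longlonglongrightarrow> L * (s' - s + 0)"
    by (intro tendsto_intros LIMSEQ_power_zero) auto
  moreover have "(\<lambda>n. dist (polygon n s) (polygon n s')) \<longlonglongrightarrow> dist (\<sigma> s) (\<sigma> s')"
    using polygon_tendsto in_dom by (intro tendsto_intros) auto
  ultimately show ?thesis using LIMSEQ_le[where y = "L * (s' - s + 0)"] by auto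
qed

lemma \<sigma>_lipschitz:
  assumes "s \<in> {t..t+c}" "s' \<in> {t..t+c}"
  shows "dist (\<sigma> s) (\<sigma> s') \<le> L * \<bar>s' - s\<bar>"
proof (cases "s \<le> s'")
  case False
  then show ?thesis using \<sigma>_lipschitz_aux[of s' s] assms by (simp add: dist_commute)
qed (use \<sigma>_lipschitz_aux[of s s'] assms in auto)

section \<open>The limit curve on the dyadic grid, and tangency off the grid\<close>

lemma polygon_grid: "polygon (n + m) (t + real k * (1/2)^n) = euler G ((1/2)^(n+m)) t a (k * 2^m)"
proof -
  have "(t + real k * (1/2)^n - t) * 2^(n+m) = of_int (int (k * 2^m))"
    by (simp add: power_add power_one_over)
  then show ?thesis unfolding polygon_def by (metis floor_of_int nat_int)
qed

text \<open>By \<open>euler_add\<close>, a finer polygon beyond the grid point \<open>s\<close> is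
  an Euler iterate restarted from its own value at \<open>s\<close>.
  \<open>euler_refine_many\<close> compares it with \<open>N\<close> coarse steps from the same
  value, with a bound independent of \<open>m\<close>. Lipschitz dependence replaces that value by
  \<open>\<sigma> s\<close>, at a price that vanishes as \<open>m\<close> grows.\<close>

lemma \<sigma>_grid:
  assumes "real (k + N) * (1/2)^n \<le> c"
  defines "s \<equiv> t + real k * (1/2)^n"
  shows "dist (euler G ((1/2)^n) s (\<sigma> s) N) (\<sigma> (s + real N * (1/2)^n))
    \<le> exp (K * c) * (real N * (1/2)^n) * (\<Sum>i. w (i + Suc n))"
proof -
  let ?\<tau> = "(1/2)^n :: real"
  let ?B = "exp (K * c) * (real N * ?\<tau>) * (\<Sum>i. w (i + Suc n))"
  have s: "s \<in> {t..t+c}" "s + real N * ?\<tau> \<in> {t..t+c}"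
    using assms(1) by (auto simp: s_def algebra_simps)
      (smt (verit) mult_nonneg_nonneg of_nat_0_le_iff zero_le_power divide_nonneg_nonneg)
  have le: "s + real N * ?\<tau> \<le> t + c" using s by simp
  have "dist (euler G ?\<tau> s (\<sigma> s) N) (polygon (n+m) (s + real N * ?\<tau>))
    \<le> exp (K * (real N * ?\<tau>)) * dist (\<sigma> s) (polygon (n+m) s) + ?B" for m
  proof -
    let ?x = "polygon (n+m) s"
    have cx: "cone s ?x" using polygon_cone s by blast
    have 1: "dist (euler G ?\<tau> s (\<sigma> s) N) (euler G ?\<tau> s ?x N) \<le> exp (K * (real N * ?\<tau>)) * dist (\<sigma> s) ?x"
      by (intro euler_lipschitz \<sigma>_cone s cx le) auto
    have g: "s + real N * ?\<tau> = t + real (k + N) * ?\<tau>" by (simp add: s_def algebra_simps)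
    have e: "real (k * 2^m) * (1/2)^(n+m) = real k * ?\<tau>"
      by (simp add: power_add power_one_over)
    have "polygon (n+m) (s + real N * ?\<tau>) = euler G ((1/2)^(n+m)) t a (k * 2^m + N * 2^m)"
      unfolding g polygon_grid by (simp add: algebra_simps)
    also have "\<dots> = euler G ((1/2)^(n+m)) s ?x (N * 2^m)"
      unfolding euler_add e by (simp add: s_def polygon_grid)
    finally have eq: "polygon (n+m) (s + real N * ?\<tau>) = euler G ((1/2)^(n+m)) s ?x (N * 2^m)" .
    have "(\<Sum>i<m. w (i + Suc n)) \<le> (\<Sum>i. w (i + Suc n))"
      using w by (intro sum_le_suminf) (auto simp: summable_iff_shift[of w "Suc n"] simp del: add_Suc_right)
    then have "exp (K * c) * (real N * ?\<tau>) * (\<Sum>i<m. w (i + Suc n)) \<le> ?B"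
      by (intro mult_left_mono) auto
    then have "dist (euler G ?\<tau> s ?x N) (polygon (n+m) (s + real N * ?\<tau>)) \<le> ?B"
      unfolding eq using euler_refine_many[OF cx le, of m] by linarith
    with 1 show ?thesis
      using dist_triangle[of "euler G ?\<tau> s (\<sigma> s) N" "polygon (n+m) (s + real N * ?\<tau>)" "euler G ?\<tau> s ?x N"]
      by linarith
  qed
  moreover have lim: "(\<lambda>m. polygon (n+m) u) \<longlonglongrightarrow> \<sigma> u" if "u \<in> {t..t+c}" for u
    using LIMSEQ_ignore_initial_segment[OF polygon_tendsto[OF that], of n] by (simp add: add.commute)
  have "(\<lambda>m. dist (euler G ?\<tau> s (\<sigma> s) N) (polygon (n+m) (s + real N * ?\<tau>)))
      \<longlonglongrightarrow> dist (euler G ?\<tau> s (\<sigma> s) N) (\<sigma> (s + real N * ?\<tau>))"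
    by (intro tendsto_intros lim s)
  moreover have "(\<lambda>m. exp (K * (real N * ?\<tau>)) * dist (\<sigma> s) (polygon (n+m) s) + ?B)
      \<longlonglongrightarrow> exp (K * (real N * ?\<tau>)) * dist (\<sigma> s) (\<sigma> s) + ?B"
    by (intro tendsto_intros lim s)
  ultimately show ?thesis
    using LIMSEQ_le[where y = "exp (K * (real N * ?\<tau>)) * dist (\<sigma> s) (\<sigma> s) + ?B"] by auto
qed

text \<open>The path of comparison leads from \<open>\<sigma> (s + h)\<close> to the curve at a grid
  point, to \<open>N\<close> Euler steps from the grid point \<open>s'\<close>, to a single step of
  length \<open>N * \<tau>\<close> from \<open>\<sigma> s'\<close>, to the same step from
  \<open>\<sigma> s\<close>, and to \<open>G s h (\<sigma> s)\<close>. The refinement tail, the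
  consistency error, the modulus from \<open>regular\<close> and the sum of all rounding errors each
  receive \<open>e / 4 * h\<close>.\<close>

lemma \<sigma>_tangent:
  assumes s: "s \<in> {t..<t+c}" and e: "0 < e"
  shows "\<exists>\<eta>>0. \<forall>h\<in>{0<..<\<eta>}. dist (\<sigma> (s + h)) (G s h (\<sigma> s)) \<le> e * h"
proof -
  \<comment> \<open>The sum of the three coefficients of \<tau> that arise from rounding
    \<open>s\<close> to the grid and \<open>h\<close> to a multiple of \<tau>. \<open>N0\<close> is
    so large that \<open>A * \<tau>\<close> is at most \<open>e / 4 * (N0 * \<tau>)\<close>, hence
    at most \<open>e / 4 * h\<close>.\<close>
  define A where "A = L + (1 + K * \<delta>) * L + L"
  obtain N0 :: nat where "max 1 (4 * A / e) \<le> real N0" using real_arch_simple by blast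
  then have N0: "1 \<le> real N0" "A \<le> e / 4 * real N0" using e by (auto simp: field_simps)
  obtain n1 where n1: "\<And>n. n \<ge> n1 \<Longrightarrow> norm (\<Sum>i. w (i + n)) < e / (4 * exp (K * c))"
    using suminf_exist_split[of "e / (4 * exp (K * c))" w] e w by auto
  have ball_s: "\<sigma> s \<in> ball a \<delta>" "s \<in> {t..t+\<delta>}" using cone_ball[OF \<sigma>_cone] s by auto
  have "\<forall>N. \<exists>\<eta>>0. \<forall>\<tau>\<in>{0<..<\<eta>}. \<forall>s'\<in>{s..<s+\<eta>}. \<forall>x\<in>ball (\<sigma> s) \<eta>.
     dist (G s' (real N * \<tau>) x) (euler G \<tau> s' x N) \<le> e / 4 * \<tau>"
    using consistent[of s "\<sigma> s" "e / 4"] e s c ball_s by auto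
  then obtain E where E: "\<And>N. 0 < E N" "\<And>N \<tau> s' x. \<lbrakk>\<tau> \<in> {0<..<E N}; s' \<in> {s..<s + E N}; x \<in> ball (\<sigma> s) (E N)\<rbrakk>
     \<Longrightarrow> dist (G s' (real N * \<tau>) x) (euler G \<tau> s' x N) \<le> e / 4 * \<tau>" by metis
  \<comment> \<open>Only the finitely many \<open>N\<close> up to \<open>2 * N0\<close> can occur
    below, so one scale serves all of them.\<close>
  define \<eta>1 where "\<eta>1 = Min (E ` {..2 * N0})"
  have \<eta>1: "0 < \<eta>1" "\<And>N. N \<le> 2 * N0 \<Longrightarrow> \<eta>1 \<le> E N"
    using E(1) by (auto simp: \<eta>1_def)
  obtain \<eta>2 where \<eta>2: "0 < \<eta>2" "\<And>s s' \<tau> \<tau>' x. \<lbrakk>s \<in> {t..t+\<delta>}; s' \<in> {t..t+\<delta>}; \<tau> \<in> {0..\<delta>}; \<tau>' \<in> {0..\<delta>};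
      x \<in> ball a \<delta>; \<bar>s - s'\<bar> \<le> \<eta>2; \<bar>\<tau> - \<tau>'\<bar> \<le> \<eta>2\<rbrakk> \<Longrightarrow>
      dist (G s \<tau> x) (G s' \<tau>' x) \<le> L * \<bar>\<tau> - \<tau>'\<bar> + e / 4 * \<tau>"
    using regular[of "e / 4"] e by auto
  \<comment> \<open>In this order the bounds bring \<tau> and \<open>\<sigma> s'\<close> into the
    range of \<open>consistent\<close>, let \<open>regular\<close> apply, make the mesh finer than
    \<open>(1/2)^n1\<close>, and keep \<open>s' + N * \<tau>\<close> before
    \<open>t + c\<close>.\<close>
  define \<eta> where "\<eta> = Min {\<eta>1 / (L + 1), \<eta>2, real N0 * (1/2)^n1, (t + c - s) / 2}"
  have "0 < \<eta>" using \<eta>1 \<eta>2 N0 s L by (auto simp: \<eta>_def)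
  have \<eta>: "\<eta> \<le> \<eta>1 / (L + 1)" "\<eta> \<le> \<eta>2" "\<eta> \<le> real N0 * (1/2)^n1" "\<eta> \<le> (t + c - s) / 2"
    unfolding \<eta>_def by (rule Min_le; simp)+
  have "dist (\<sigma> (s + h)) (G s h (\<sigma> s)) \<le> e * h" if h: "h \<in> {0<..<\<eta>}" for h
  proof -
    have h0: "0 < h" "h < \<eta>1 / (L + 1)" "h \<le> \<eta>2" "h < real N0 * (1/2)^n1" "2 * h < t + c - s"
      using h \<eta> by auto
    have "real N0 * (1/2)^n1 \<le> real N0" by (simp add: mult_left_le power_le_one)
    then obtain n where n: "real N0 * (1/2)^n \<le> h" "h < 2 * (real N0 * (1/2)^n)"
      using dyadic_scale[of h "real N0"] h0 by (metis less_le_trans)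
    define \<tau> :: real where "\<tau> = (1/2)^n"
    have \<tau>: "0 < \<tau>" "real N0 * \<tau> \<le> h" "h < 2 * (real N0 * \<tau>)" using n by (auto simp: \<tau>_def)
    moreover have "1 * \<tau> \<le> real N0 * \<tau>" using N0(1) \<tau>(1) by (intro mult_right_mono) auto
    ultimately have \<tau>h: "\<tau> \<le> h" by linarith
    have "real N0 * (1/2)^n < real N0 * (1/2)^n1" using n h0 by linarith
    then have "(1/2::real)^n < (1/2)^n1" using N0 by simp
    then have nn1: "n1 \<le> Suc n" by (simp add: power_strict_decreasing_iff)
    \<comment> \<open>\<open>Suc\<close> rounds \<open>s\<close> up to the grid, because
      \<open>consistent\<close> based at \<open>s\<close> covers only times from \<open>s\<close>
      on.\<close>
    define k where "k = Suc (nat \<lfloor>(s - t) * 2^n\<rfloor>)"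
    define s' where "s' = t + real k * \<tau>"
    have s': "s \<le> s'" "s' \<le> s + \<tau>"
      using floor_grid[of s n] s by (auto simp: s'_def k_def \<tau>_def algebra_simps)
    define N where "N = nat \<lfloor>h * 2^n\<rfloor>"
    have N: "real N * \<tau> \<le> h" "h < real N * \<tau> + \<tau>"
      using floor_grid[of "t + h" n] h0 by (auto simp: N_def \<tau>_def algebra_simps)
    have "real N * \<tau> < real (2 * N0) * \<tau>" using N(1) \<tau>(3) by simp
    then have NN: "N \<le> 2 * N0" using \<tau>(1) by simp
    have N\<tau>: "0 \<le> real N * \<tau>" using \<tau> by simp
    have in_dom: "s \<in> {t..t+c}" "s' \<in> {t..t+c}" "s + h \<in> {t..t+c}" "s' + real N * \<tau> \<in> {t..t+c}"
      using s s' N N\<tau> \<tau> \<tau>h h0 by auto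
    have ball_s': "\<sigma> s' \<in> ball a \<delta>" "s' \<in> {t..t+\<delta>}" using cone_ball[OF \<sigma>_cone[OF in_dom(2)]] by auto
    have h\<delta>: "h \<in> {0..\<delta>}" "real N * \<tau> \<in> {0..\<delta>}" using h0 s c N N\<tau> by auto
    have lip_s: "dist (\<sigma> s) (\<sigma> s') \<le> L * \<tau>"
      using \<sigma>_lipschitz[OF in_dom(1,2)] s' L mult_left_mono[of "s' - s" \<tau> L] by auto
    have 1: "dist (\<sigma> (s + h)) (\<sigma> (s' + real N * \<tau>)) \<le> L * \<tau>"
    proof -
      have "\<bar>(s' + real N * \<tau>) - (s + h)\<bar> \<le> \<tau>" using s' N by linarith
      then show ?thesis using \<sigma>_lipschitz[OF in_dom(3,4)] L mult_left_mono order_trans by blast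
    qed
    have 2: "dist (\<sigma> (s' + real N * \<tau>)) (euler G \<tau> s' (\<sigma> s') N) \<le> e / 4 * h"
    proof -
      let ?W = "\<Sum>i. w (i + Suc n)"
      have "real (k + N) * (1/2)^n \<le> c" using in_dom(4) by (simp add: s'_def \<tau>_def algebra_simps)
      then have "dist (euler G \<tau> s' (\<sigma> s') N) (\<sigma> (s' + real N * \<tau>)) \<le> exp (K * c) * (real N * \<tau>) * ?W"
        using \<sigma>_grid[of k N n] by (simp add: s'_def \<tau>_def)
      also have "\<dots> \<le> exp (K * c) * h * (e / (4 * exp (K * c)))"
        using n1[OF nn1] N(1) h0 N\<tau> w suminf_nonneg[of "\<lambda>i. w (i + Suc n)"] summable_iff_shift[of w "Suc n"]
        by (intro mult_mono) (auto simp del: add_Suc_right)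
      also have "\<dots> = e / 4 * h" by simp
      finally show ?thesis by (simp add: dist_commute)
    qed
    have "h + L * h < \<eta>1" using h0(2) L by (simp add: field_simps)
    moreover have "L * \<tau> \<le> L * h" using \<tau>h L by (rule mult_left_mono)
    moreover have "0 \<le> L * h" using L h0(1) by simp
    ultimately have "L * \<tau> < \<eta>1" "\<tau> < \<eta>1" using \<tau>h h0(1) by linarith+
    then have "dist (euler G \<tau> s' (\<sigma> s') N) (G s' (real N * \<tau>) (\<sigma> s')) \<le> e / 4 * \<tau>"
      using E(2)[of \<tau> N s' "\<sigma> s'"] \<eta>1(2)[OF NN] s' lip_s \<tau> by (auto simp: dist_commute)
    also have "\<dots> \<le> e / 4 * h" using \<tau>h e by (intro mult_left_mono) auto
    finally have 3: "dist (euler G \<tau> s' (\<sigma> s') N) (G s' (real N * \<tau>) (\<sigma> s')) \<le> e / 4 * h" .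
    have 4: "dist (G s' (real N * \<tau>) (\<sigma> s')) (G s' (real N * \<tau>) (\<sigma> s)) \<le> (1 + K * \<delta>) * L * \<tau>"
    proof -
      have "dist (G s' (real N * \<tau>) (\<sigma> s')) (G s' (real N * \<tau>) (\<sigma> s))
        \<le> (1 + K * (real N * \<tau>)) * dist (\<sigma> s') (\<sigma> s)"
        by (intro lip ball_s ball_s' h\<delta>)
      also have "\<dots> \<le> (1 + K * \<delta>) * (L * \<tau>)"
        using lip_s h\<delta> K \<delta> by (intro mult_mono add_mono mult_left_mono) (auto simp: dist_commute)
      finally show ?thesis by simp
    qed
    have 5: "dist (G s' (real N * \<tau>) (\<sigma> s)) (G s h (\<sigma> s)) \<le> L * \<tau> + e / 4 * h"
    proof -
      have hN: "\<bar>h - real N * \<tau>\<bar> \<le> \<tau>" using N by linarith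
      have "dist (G s h (\<sigma> s)) (G s' (real N * \<tau>) (\<sigma> s)) \<le> L * \<bar>h - real N * \<tau>\<bar> + e / 4 * h"
        using hN s' h0 \<tau>h by (intro \<eta>2(2) ball_s ball_s' h\<delta>) auto
      also have "\<dots> \<le> L * \<tau> + e / 4 * h" using hN L by (simp add: mult_left_mono)
      finally show ?thesis by (simp add: dist_commute)
    qed
    have "A * \<tau> \<le> e / 4 * real N0 * \<tau>" using N0 \<tau> by (intro mult_right_mono) auto
    also have "\<dots> \<le> e / 4 * h" using \<tau>(2) e mult_left_mono[of "real N0 * \<tau>" h "e / 4"] by simp
    finally have "A * \<tau> \<le> e / 4 * h" .
    then have 6: "L * \<tau> + (1 + K * \<delta>) * L * \<tau> + L * \<tau> \<le> e / 4 * h" by (simp add: A_def algebra_simps)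
    have "dist (\<sigma> (s + h)) (G s h (\<sigma> s)) \<le> 4 * (e / 4 * h)"
      using 1 2 3 4 5 6
      dist_triangle[of "\<sigma> (s + h)" "G s h (\<sigma> s)" "\<sigma> (s' + real N * \<tau>)"]
      dist_triangle[of "\<sigma> (s' + real N * \<tau>)" "G s h (\<sigma> s)" "euler G \<tau> s' (\<sigma> s') N"]
      dist_triangle[of "euler G \<tau> s' (\<sigma> s') N" "G s h (\<sigma> s)" "G s' (real N * \<tau>) (\<sigma> s')"]
      dist_triangle[of "G s' (real N * \<tau>) (\<sigma> s')" "G s h (\<sigma> s)" "G s' (real N * \<tau>) (\<sigma> s)"]
      by linarith
    then show ?thesis by simp
  qed
  with \<open>0 < \<eta>\<close> show ?thesis by blast
qed

end

subsection \<open>First-order agreement of families of maps\<close>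

type_synonym 'a flow_family = "real \<Rightarrow> real \<Rightarrow> 'a \<Rightarrow> 'a"

text \<open>Both factors receive the same start time \<open>s\<close>; a later clock has to be built
  into a factor, which is the purpose of \<open>shifted\<close> below.\<close>

definition family_comp :: "'a flow_family \<Rightarrow> 'a flow_family \<Rightarrow> 'a flow_family" (infixr "\<odot>" 65) where
  "(f \<odot> g) s \<tau> x = f s \<tau> (g s \<tau> x)"

lemma family_comp_assoc: "(f \<odot> g) \<odot> h = f \<odot> g \<odot> h"
  by (simp add: family_comp_def fun_eq_iff)

text \<open>Agreement up to o(\<tau>), uniformly in start points near \<open>p\<close> and start
  times just after \<open>s0\<close>. The uniformity lets the relation survive composition, where
  the outer map acts at a moved point.\<close>

definition tangent_at :: "real \<Rightarrow> 'a \<Rightarrow> ('a::metric_space) flow_family \<Rightarrow> 'a flow_family \<Rightarrow> bool" where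
  "tangent_at s0 p f g \<longleftrightarrow> (\<forall>e>0. \<exists>\<eta>>0. \<forall>\<tau>\<in>{0<..<\<eta>}. \<forall>s\<in>{s0..<s0+\<eta>}. \<forall>x\<in>ball p \<eta>.
     dist (f s \<tau> x) (g s \<tau> x) \<le> e * \<tau>)"

text \<open>The speed bound keeps moved points near \<open>p\<close>, and the Lipschitz bound
  transports errors through later factors. A crude factor \<open>B\<close> is enough because the
  words to be compared have a fixed length.\<close>

definition tame_at :: "real \<Rightarrow> 'a \<Rightarrow> ('a::metric_space) flow_family \<Rightarrow> bool" where
  "tame_at s0 p f \<longleftrightarrow> (\<exists>B\<ge>0. \<exists>\<eta>>0. \<forall>\<tau>\<in>{0<..<\<eta>}. \<forall>s\<in>{s0..<s0+\<eta>}. \<forall>x\<in>ball p \<eta>.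
     dist x (f s \<tau> x) \<le> B * \<tau> \<and> (\<forall>y\<in>ball p \<eta>. dist (f s \<tau> x) (f s \<tau> y) \<le> B * dist x y))"

lemma tangent_atD:
  assumes "tangent_at s0 p f g" "0 < e"
  obtains \<eta> where "0 < \<eta>" "\<And>s \<tau> x. \<lbrakk>\<tau> \<in> {0<..<\<eta>}; s \<in> {s0..<s0+\<eta>}; x \<in> ball p \<eta>\<rbrakk>
    \<Longrightarrow> dist (f s \<tau> x) (g s \<tau> x) \<le> e * \<tau>"
  using assms unfolding tangent_at_def by meson

lemma tame_atD:
  assumes "tame_at s0 p f"
  obtains B \<eta> where "0 \<le> B" "0 < \<eta>"
    "\<And>s \<tau> x. \<lbrakk>\<tau> \<in> {0<..<\<eta>}; s \<in> {s0..<s0+\<eta>}; x \<in> ball p \<eta>\<rbrakk> \<Longrightarrow> dist x (f s \<tau> x) \<le> B * \<tau>"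
    "\<And>s \<tau> x y. \<lbrakk>\<tau> \<in> {0<..<\<eta>}; s \<in> {s0..<s0+\<eta>}; x \<in> ball p \<eta>; y \<in> ball p \<eta>\<rbrakk>
      \<Longrightarrow> dist (f s \<tau> x) (f s \<tau> y) \<le> B * dist x y"
  using assms unfolding tame_at_def by meson

lemma tangent_at_sym: "tangent_at s0 p f g \<Longrightarrow> tangent_at s0 p g f"
  by (simp add: tangent_at_def dist_commute)

lemma tangent_at_trans [trans]:
  assumes "tangent_at s0 p f g" "tangent_at s0 p g h"
  shows "tangent_at s0 p f h"
  unfolding tangent_at_def
proof (intro allI impI)
  fix e :: real assume "0 < e"
  then have e: "0 < e / 2" by simp
  obtain \<eta>1 where 1: "0 < \<eta>1" "\<And>s \<tau> x. \<lbrakk>\<tau> \<in> {0<..<\<eta>1}; s \<in> {s0..<s0+\<eta>1}; x \<in> ball p \<eta>1\<rbrakk>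
    \<Longrightarrow> dist (f s \<tau> x) (g s \<tau> x) \<le> e / 2 * \<tau>"
    using tangent_atD[OF assms(1) e] by metis
  obtain \<eta>2 where 2: "0 < \<eta>2" "\<And>s \<tau> x. \<lbrakk>\<tau> \<in> {0<..<\<eta>2}; s \<in> {s0..<s0+\<eta>2}; x \<in> ball p \<eta>2\<rbrakk>
    \<Longrightarrow> dist (g s \<tau> x) (h s \<tau> x) \<le> e / 2 * \<tau>"
    using tangent_atD[OF assms(2) e] by metis
  have "dist (f s \<tau> x) (h s \<tau> x) \<le> e * \<tau>"
    if "\<tau> \<in> {0<..<min \<eta>1 \<eta>2}" "s \<in> {s0..<s0 + min \<eta>1 \<eta>2}" "x \<in> ball p (min \<eta>1 \<eta>2)" for s \<tau> x
  proof -
    have "s \<in> {s0..<s0+\<eta>1}" "s \<in> {s0..<s0+\<eta>2}" using that by auto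
    then show ?thesis
      using 1(2)[of \<tau> s x] 2(2)[of \<tau> s x] that dist_triangle[of "f s \<tau> x" "h s \<tau> x" "g s \<tau> x"] by simp
  qed
  then show "\<exists>\<eta>>0. \<forall>\<tau>\<in>{0<..<\<eta>}. \<forall>s\<in>{s0..<s0+\<eta>}. \<forall>x\<in>ball p \<eta>. dist (f s \<tau> x) (h s \<tau> x) \<le> e * \<tau>"
    using 1(1) 2(1) by (intro exI[of _ "min \<eta>1 \<eta>2"]) auto
qed

text \<open>The comparison goes through \<open>f s \<tau> (g' s \<tau> x)\<close>: the error of
  \<open>g\<close> against \<open>g'\<close> is multiplied by the Lipschitz constant of
  \<open>f\<close>, and the error of \<open>f\<close> against \<open>f'\<close> is taken at the
  moved point.\<close>

lemma tangent_at_comp: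
  assumes "tangent_at s0 p f f'" "tangent_at s0 p g g'" "tame_at s0 p f" "tame_at s0 p g" "tame_at s0 p g'"
  shows "tangent_at s0 p (f \<odot> g) (f' \<odot> g')"
  unfolding tangent_at_def
proof (intro allI impI)
  fix e :: real assume e: "0 < e"
  obtain B \<eta>f where f: "0 \<le> B" "0 < \<eta>f"
    "\<And>s \<tau> x y. \<lbrakk>\<tau> \<in> {0<..<\<eta>f}; s \<in> {s0..<s0+\<eta>f}; x \<in> ball p \<eta>f; y \<in> ball p \<eta>f\<rbrakk>
      \<Longrightarrow> dist (f s \<tau> x) (f s \<tau> y) \<le> B * dist x y"
    using tame_atD[OF assms(3)] by metis
  obtain Bg \<eta>g where g: "0 \<le> Bg" "0 < \<eta>g"
    "\<And>s \<tau> x. \<lbrakk>\<tau> \<in> {0<..<\<eta>g}; s \<in> {s0..<s0+\<eta>g}; x \<in> ball p \<eta>g\<rbrakk> \<Longrightarrow> dist x (g s \<tau> x) \<le> Bg * \<tau>"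
    using tame_atD[OF assms(4)] by metis
  obtain Bg' \<eta>g' where g': "0 \<le> Bg'" "0 < \<eta>g'"
    "\<And>s \<tau> x. \<lbrakk>\<tau> \<in> {0<..<\<eta>g'}; s \<in> {s0..<s0+\<eta>g'}; x \<in> ball p \<eta>g'\<rbrakk> \<Longrightarrow> dist x (g' s \<tau> x) \<le> Bg' * \<tau>"
    using tame_atD[OF assms(5)] by metis
  have e1: "0 < e / (2 * (B + 1))" "0 < e / 2" using e f by auto
  obtain \<eta>1 where 1: "0 < \<eta>1" "\<And>s \<tau> x. \<lbrakk>\<tau> \<in> {0<..<\<eta>1}; s \<in> {s0..<s0+\<eta>1}; x \<in> ball p \<eta>1\<rbrakk>
    \<Longrightarrow> dist (g s \<tau> x) (g' s \<tau> x) \<le> e / (2 * (B + 1)) * \<tau>"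
    using tangent_atD[OF assms(2) e1(1)] by metis
  obtain \<eta>2 where 2: "0 < \<eta>2" "\<And>s \<tau> x. \<lbrakk>\<tau> \<in> {0<..<\<eta>2}; s \<in> {s0..<s0+\<eta>2}; x \<in> ball p \<eta>2\<rbrakk>
    \<Longrightarrow> dist (f s \<tau> x) (f' s \<tau> x) \<le> e / 2 * \<tau>"
    using tangent_atD[OF assms(1) e1(2)] by metis
  \<comment> \<open>\<open>g\<close> and \<open>g'\<close> carry points within \<eta> of
    \<open>p\<close> to points within \<open>\<eta> * D\<close> of \<open>p\<close>, hence the
    quotients by \<open>D\<close> in the radius.\<close>
  define D where "D = 1 + Bg + Bg'"
  define \<eta> where "\<eta> = Min {\<eta>f / D, \<eta>g, \<eta>g', \<eta>1, \<eta>2 / D}"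
  have D: "1 \<le> D" "Bg \<le> D - 1" "Bg' \<le> D - 1" using g g' by (auto simp: D_def)
  have "0 < \<eta>" using D f g g' 1 2 by (auto simp: \<eta>_def)
  have "\<eta> \<le> \<eta>f / D" "\<eta> \<le> \<eta>2 / D" and \<eta>: "\<eta> \<le> \<eta>g" "\<eta> \<le> \<eta>g'" "\<eta> \<le> \<eta>1"
    unfolding \<eta>_def by (rule Min_le; simp)+
  then have \<eta>D: "\<eta> * D \<le> \<eta>f" "\<eta> * D \<le> \<eta>2" using D by (auto simp: field_simps)
  moreover have "\<eta> \<le> \<eta> * D" using D \<open>0 < \<eta>\<close> by simp
  ultimately have \<eta>': "\<eta> \<le> \<eta>f" "\<eta> \<le> \<eta>2" by auto
  have "dist ((f \<odot> g) s \<tau> x) ((f' \<odot> g') s \<tau> x) \<le> e * \<tau>"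
    if z: "\<tau> \<in> {0<..<\<eta>}" "s \<in> {s0..<s0+\<eta>}" "x \<in> ball p \<eta>" for s \<tau> x
  proof -
    have gx: "dist x (g s \<tau> x) \<le> Bg * \<tau>" "dist x (g' s \<tau> x) \<le> Bg' * \<tau>"
      using g(3)[of \<tau> s x] g'(3)[of \<tau> s x] z \<eta> by auto
    have "Bg * \<tau> \<le> (D - 1) * \<eta>" "Bg' * \<tau> \<le> (D - 1) * \<eta>"
      using z D g g' by (auto intro!: mult_mono)
    then have "dist p (g s \<tau> x) < \<eta> * D" "dist p (g' s \<tau> x) < \<eta> * D"
      using gx z(3) dist_triangle[of p "g s \<tau> x" x] dist_triangle[of p "g' s \<tau> x" x]
      by (auto simp: algebra_simps)
    then have in_ball: "g s \<tau> x \<in> ball p \<eta>f" "g' s \<tau> x \<in> ball p \<eta>f" "g' s \<tau> x \<in> ball p \<eta>2"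
      using \<eta>D by auto
    have "dist (f s \<tau> (g s \<tau> x)) (f s \<tau> (g' s \<tau> x)) \<le> B * dist (g s \<tau> x) (g' s \<tau> x)"
      using f(3) in_ball z \<eta>' by auto
    also have "\<dots> \<le> B * (e / (2 * (B + 1)) * \<tau>)"
      using 1(2)[of \<tau> s x] z \<eta> f by (intro mult_left_mono) auto
    also have "\<dots> \<le> (B + 1) * (e / (2 * (B + 1)) * \<tau>)"
      using f e z by (intro mult_right_mono) auto
    also have "\<dots> = e / 2 * \<tau>" using f by (simp add: field_simps)
    finally have "dist (f s \<tau> (g s \<tau> x)) (f s \<tau> (g' s \<tau> x)) \<le> e / 2 * \<tau>" .
    moreover have "dist (f s \<tau> (g' s \<tau> x)) (f' s \<tau> (g' s \<tau> x)) \<le> e / 2 * \<tau>"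
      using 2(2) in_ball z \<eta>' by auto
    ultimately show ?thesis
      using dist_triangle[of "f s \<tau> (g s \<tau> x)" "f' s \<tau> (g' s \<tau> x)" "f s \<tau> (g' s \<tau> x)"]
      by (simp add: family_comp_def)
  qed
  with \<open>0 < \<eta>\<close> show "\<exists>\<eta>>0. \<forall>\<tau>\<in>{0<..<\<eta>}. \<forall>s\<in>{s0..<s0+\<eta>}. \<forall>x\<in>ball p \<eta>.
      dist ((f \<odot> g) s \<tau> x) ((f' \<odot> g') s \<tau> x) \<le> e * \<tau>" by blast
qed

lemma tangent_at_refl: "tangent_at s0 p f f"
  unfolding tangent_at_def by (auto intro: exI[of _ 1])

lemma tame_at_comp:
  assumes "tame_at s0 p f" "tame_at s0 p g"
  shows "tame_at s0 p (f \<odot> g)"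
proof -
  obtain Bf \<eta>f where f: "0 \<le> Bf" "0 < \<eta>f"
    "\<And>s \<tau> x. \<lbrakk>\<tau> \<in> {0<..<\<eta>f}; s \<in> {s0..<s0+\<eta>f}; x \<in> ball p \<eta>f\<rbrakk> \<Longrightarrow> dist x (f s \<tau> x) \<le> Bf * \<tau>"
    "\<And>s \<tau> x y. \<lbrakk>\<tau> \<in> {0<..<\<eta>f}; s \<in> {s0..<s0+\<eta>f}; x \<in> ball p \<eta>f; y \<in> ball p \<eta>f\<rbrakk>
      \<Longrightarrow> dist (f s \<tau> x) (f s \<tau> y) \<le> Bf * dist x y"
    using tame_atD[OF assms(1)] by metis
  obtain Bg \<eta>g where g: "0 \<le> Bg" "0 < \<eta>g"
    "\<And>s \<tau> x. \<lbrakk>\<tau> \<in> {0<..<\<eta>g}; s \<in> {s0..<s0+\<eta>g}; x \<in> ball p \<eta>g\<rbrakk> \<Longrightarrow> dist x (g s \<tau> x) \<le> Bg * \<tau>"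
    "\<And>s \<tau> x y. \<lbrakk>\<tau> \<in> {0<..<\<eta>g}; s \<in> {s0..<s0+\<eta>g}; x \<in> ball p \<eta>g; y \<in> ball p \<eta>g\<rbrakk>
      \<Longrightarrow> dist (g s \<tau> x) (g s \<tau> y) \<le> Bg * dist x y"
    using tame_atD[OF assms(2)] by metis
  define \<eta> where "\<eta> = min (\<eta>f / (1 + Bg)) \<eta>g"
  have "0 < \<eta>" using f g by (auto simp: \<eta>_def)
  have "\<eta> \<le> \<eta>f / (1 + Bg)" by (simp add: \<eta>_def)
  then have \<eta>: "\<eta> + \<eta> * Bg \<le> \<eta>f" using g(1) by (simp add: field_simps)
  have \<eta>g: "\<eta> \<le> \<eta>g" by (simp add: \<eta>_def)
  have nn: "0 \<le> \<eta> * Bg" using \<open>0 < \<eta>\<close> g by simp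
  \<comment> \<open>\<open>Bf + Bg\<close> bounds the speed and \<open>Bf * Bg\<close> the Lipschitz
    constant; their sum serves for both.\<close>
  have "dist x (f s \<tau> (g s \<tau> x)) \<le> (Bf + Bg + Bf * Bg) * \<tau> \<and>
    (\<forall>y\<in>ball p \<eta>. dist (f s \<tau> (g s \<tau> x)) (f s \<tau> (g s \<tau> y)) \<le> (Bf + Bg + Bf * Bg) * dist x y)"
    if z: "\<tau> \<in> {0<..<\<eta>}" "s \<in> {s0..<s0+\<eta>}" "x \<in> ball p \<eta>" for s \<tau> x
  proof -
    have gb: "g s \<tau> y \<in> ball p \<eta>f" if "y \<in> ball p \<eta>" for y
    proof -
      have "dist y (g s \<tau> y) \<le> Bg * \<tau>" using g(3) z that \<eta>g by auto
      moreover have "Bg * \<tau> \<le> Bg * \<eta>" using z g by (intro mult_left_mono) auto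
      ultimately show ?thesis using that \<eta> dist_triangle[of p "g s \<tau> y" y] by (auto simp: mult.commute)
    qed
    have 1: "dist x (g s \<tau> x) \<le> Bg * \<tau>" using g(3) z \<eta> \<eta>g by auto
    have 2: "dist (g s \<tau> x) (f s \<tau> (g s \<tau> x)) \<le> Bf * \<tau>" using f(3) gb z \<eta> \<eta>g nn by auto
    have "0 \<le> Bf * Bg * \<tau>" using f g z by auto
    with 1 2 have "dist x (f s \<tau> (g s \<tau> x)) \<le> (Bf + Bg + Bf * Bg) * \<tau>"
      using dist_triangle[of x "f s \<tau> (g s \<tau> x)" "g s \<tau> x"] by (auto simp: algebra_simps)
    moreover have "dist (f s \<tau> (g s \<tau> x)) (f s \<tau> (g s \<tau> y)) \<le> (Bf + Bg + Bf * Bg) * dist x y"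
      if y: "y \<in> ball p \<eta>" for y
    proof -
      have "dist (f s \<tau> (g s \<tau> x)) (f s \<tau> (g s \<tau> y)) \<le> Bf * dist (g s \<tau> x) (g s \<tau> y)"
        using f(4) gb z y \<eta> \<eta>g nn by auto
      also have "\<dots> \<le> Bf * (Bg * dist x y)" using g(4) z y \<eta> \<eta>g f by (intro mult_left_mono) auto
      also have "\<dots> \<le> (Bf + Bg + Bf * Bg) * dist x y" using f g by (simp add: algebra_simps)
      finally show ?thesis .
    qed
    ultimately show ?thesis by blast
  qed
  moreover have "0 \<le> Bf + Bg + Bf * Bg" using f g by simp
  ultimately show ?thesis using \<open>0 < \<eta>\<close> unfolding tame_at_def family_comp_def by blast
qed

section \<open>A single arc field with uniform local constants\<close>

lemma ex_powr_le:
  fixes \<alpha> e :: real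
  assumes "0 < \<alpha>" "0 < e"
  obtains \<eta> where "0 < \<eta>" "\<And>u. \<lbrakk>0 \<le> u; u \<le> \<eta>\<rbrakk> \<Longrightarrow> u powr \<alpha> \<le> e"
proof
  show "0 < e powr (1 / \<alpha>)" using assms by simp
  fix u assume "0 \<le> u" "u \<le> e powr (1 / \<alpha>)"
  then have "u powr \<alpha> \<le> (e powr (1 / \<alpha>)) powr \<alpha>" using assms by (intro powr_mono2) auto
  then show "u powr \<alpha> \<le> e" using assms by (simp add: powr_powr)
qed

locale local_arc =
  fixes \<Phi> :: "('a::metric_space) arc_map" and a :: 'a and t \<delta> M \<alpha> :: real and v :: "nat \<Rightarrow> real"
  assumes \<delta>: "0 < \<delta>" "\<delta> \<le> 1" and M: "0 \<le> M" and \<alpha>: "0 < \<alpha>"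
    and v: "\<And>i. 0 \<le> v i" "summable v"
    and at_0: "\<And>s x. s \<in> {t..t+\<delta>} \<Longrightarrow> \<Phi> s x 0 = x"
    and speed: "\<And>s x h k. \<lbrakk>s \<in> {t..t+\<delta>}; x \<in> ball a \<delta>; h \<in> {0..\<delta>}; k \<in> {0..\<delta>}\<rbrakk>
       \<Longrightarrow> dist (\<Phi> s x h) (\<Phi> s x k) \<le> M * \<bar>h - k\<bar>"
    and lipschitz: "\<And>s x y h. \<lbrakk>s \<in> {t..t+\<delta>}; x \<in> ball a \<delta>; y \<in> ball a \<delta>; h \<in> {0..\<delta>}\<rbrakk>
       \<Longrightarrow> dist (\<Phi> s x h) (\<Phi> s y h) \<le> (1 + M * h) * dist x y"
    and semigroup_dyadic: "\<And>s x i. \<lbrakk>s \<in> {t..t+\<delta>}; x \<in> ball a \<delta>; (1/2)^i \<le> \<delta>\<rbrakk>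
       \<Longrightarrow> dist (\<Phi> s x (2 * (1/2)^i)) (\<Phi> s (\<Phi> s x ((1/2)^i)) ((1/2)^i)) \<le> (1/2)^i * v i"
    and semigroup_small: "\<And>e. 0 < e \<Longrightarrow> \<exists>\<eta>>0. \<forall>s\<in>{t..t+\<delta>}. \<forall>x\<in>ball a \<delta>. \<forall>l\<in>{0..<\<eta>}. \<forall>h\<in>{0..<\<eta>}.
       dist (\<Phi> s x (l + h)) (\<Phi> s (\<Phi> s x l) h) \<le> e * h"
    and hoelder: "\<And>s s' x h. \<lbrakk>s \<in> {t..t+\<delta>}; s' \<in> {t..t+\<delta>}; x \<in> ball a \<delta>; h \<in> {0..\<delta>}\<rbrakk>
       \<Longrightarrow> dist (\<Phi> s x h) (\<Phi> s' x h) \<le> M * h * \<bar>s - s'\<bar> powr \<alpha>"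
begin

lemma move: "\<lbrakk>s \<in> {t..t+\<delta>}; x \<in> ball a \<delta>; h \<in> {0..\<delta>}\<rbrakk> \<Longrightarrow> dist x (\<Phi> s x h) \<le> M * h"
  using speed[of s x 0 h] at_0[of s x] by simp

text \<open>A move that starts \<theta> * \<tau> late and lasts c * \<tau>. Every move in an Euler
  step or in one long step has this form with \<theta> and c independent of \<tau>.\<close>

definition shifted :: "real \<Rightarrow> real \<Rightarrow> 'a flow_family" where
  "shifted \<theta> c s \<tau> x = \<Phi> (s + \<theta> * \<tau>) x (c * \<tau>)"

lemma small_scale:
  assumes base: "s0 \<in> {t..<t+\<delta>}" "p \<in> ball a \<delta>" and "0 \<le> \<theta>" "0 \<le> c"
  obtains \<eta> where "0 < \<eta>" "\<And>s \<tau>. \<lbrakk>\<tau> \<in> {0<..<\<eta>}; s \<in> {s0..<s0+\<eta>}\<rbrakk> \<Longrightarrow> s \<in> {t..t+\<delta>} \<and> s + \<theta> * \<tau> \<in> {t..t+\<delta>} \<and> c * \<tau> \<in> {0..\<delta>}"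
    "ball p \<eta> \<subseteq> ball a \<delta>"
proof -
  define \<eta> where "\<eta> = Min {(t + \<delta> - s0) / (1 + \<theta>), \<delta> / (1 + c), \<delta> - dist a p}"
  have pos: "0 < \<eta>" using assms \<delta> by (auto simp: \<eta>_def)
  have "\<eta> \<le> (t + \<delta> - s0) / (1 + \<theta>)" "\<eta> \<le> \<delta> / (1 + c)" and b: "\<eta> \<le> \<delta> - dist a p"
    unfolding \<eta>_def by (rule Min_le; simp)+
  then have 1: "\<eta> + \<theta> * \<eta> \<le> t + \<delta> - s0" "\<eta> + c * \<eta> \<le> \<delta>" using assms by (auto simp: field_simps)
  have "s \<in> {t..t+\<delta>} \<and> s + \<theta> * \<tau> \<in> {t..t+\<delta>} \<and> c * \<tau> \<in> {0..\<delta>}" if z: "\<tau> \<in> {0<..<\<eta>}" "s \<in> {s0..<s0+\<eta>}" for s \<tau>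
  proof -
    have "\<theta> * \<tau> \<le> \<theta> * \<eta>" "c * \<tau> \<le> c * \<eta>" "0 \<le> \<theta> * \<tau>" "0 \<le> c * \<tau>"
      using z assms by (auto intro: mult_left_mono)
    moreover have "t \<le> s0" "0 < \<tau>" "\<tau> < \<eta>" "s0 \<le> s" "s < s0 + \<eta>" using z base by auto
    ultimately show ?thesis using 1 unfolding atLeastAtMost_iff by linarith
  qed
  moreover have "ball p \<eta> \<subseteq> ball a \<delta>"
  proof
    fix x assume "x \<in> ball p \<eta>"
    then show "x \<in> ball a \<delta>" using b dist_triangle[of a x p] by auto
  qed
  ultimately show ?thesis using pos that by blast
qed

context
  fixes s0 p assumes base: "s0 \<in> {t..<t+\<delta>}" "p \<in> ball a \<delta>"
begin

lemma tame_shifted: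
  assumes "0 \<le> \<theta>" "0 \<le> c"
  shows "tame_at s0 p (shifted \<theta> c)"
proof -
  obtain \<eta> where \<eta>: "0 < \<eta>" "\<And>s \<tau>. \<lbrakk>\<tau> \<in> {0<..<\<eta>}; s \<in> {s0..<s0+\<eta>}\<rbrakk> \<Longrightarrow> s \<in> {t..t+\<delta>} \<and> s + \<theta> * \<tau> \<in> {t..t+\<delta>} \<and> c * \<tau> \<in> {0..\<delta>}"
    "ball p \<eta> \<subseteq> ball a \<delta>"
    using small_scale[OF base assms] by metis
  have "dist x (shifted \<theta> c s \<tau> x) \<le> (1 + M + M * c) * \<tau> \<and>
      (\<forall>y\<in>ball p \<eta>. dist (shifted \<theta> c s \<tau> x) (shifted \<theta> c s \<tau> y) \<le> (1 + M + M * c) * dist x y)"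
    if z: "\<tau> \<in> {0<..<\<eta>}" "s \<in> {s0..<s0+\<eta>}" "x \<in> ball p \<eta>" for s \<tau> x
  proof -
    have d: "s + \<theta> * \<tau> \<in> {t..t+\<delta>}" "c * \<tau> \<in> {0..\<delta>}" "x \<in> ball a \<delta>" using \<eta> z by blast+
    have "M * (c * \<tau>) \<le> (1 + M + M * c) * \<tau>" using z M by (simp add: algebra_simps)
    then have "dist x (shifted \<theta> c s \<tau> x) \<le> (1 + M + M * c) * \<tau>"
      using move[OF d(1,3,2)] by (simp add: shifted_def)
    moreover have "dist (shifted \<theta> c s \<tau> x) (shifted \<theta> c s \<tau> y) \<le> (1 + M + M * c) * dist x y"
      if "y \<in> ball p \<eta>" for y
    proof -
      have "y \<in> ball a \<delta>" using that \<eta> by blast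
      then have "dist (shifted \<theta> c s \<tau> x) (shifted \<theta> c s \<tau> y) \<le> (1 + M * (c * \<tau>)) * dist x y"
        using lipschitz[OF d(1,3) _ d(2)] by (simp add: shifted_def)
      also have "\<dots> \<le> (1 + M + M * c) * dist x y"
      proof -
        have "M * (c * \<tau>) \<le> M * 1" using d \<delta> M by (intro mult_left_mono) auto
        then show ?thesis using M assms by (intro mult_right_mono) (auto intro: add_increasing2)
      qed
      finally show ?thesis .
    qed
    ultimately show ?thesis by blast
  qed
  moreover have "0 \<le> 1 + M + M * c" using M assms by simp
  ultimately show ?thesis unfolding tame_at_def using \<eta>(1) by blast
qed

text \<open>By condition C a delay of \<theta> * \<tau> costs at most
  \<open>M * (c * \<tau>) * (\<theta> * \<tau>) powr \<alpha>\<close>, which is o(\<tau>). To first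
  order the clocks can therefore be ignored.\<close>

lemma tangent_shifted:
  assumes "0 \<le> \<theta>" "0 \<le> c"
  shows "tangent_at s0 p (shifted \<theta> c) (shifted 0 c)"
  unfolding tangent_at_def
proof (intro allI impI)
  fix e :: real assume e: "0 < e"
  obtain \<eta> where \<eta>: "0 < \<eta>" "\<And>s \<tau>. \<lbrakk>\<tau> \<in> {0<..<\<eta>}; s \<in> {s0..<s0+\<eta>}\<rbrakk> \<Longrightarrow> s \<in> {t..t+\<delta>} \<and> s + \<theta> * \<tau> \<in> {t..t+\<delta>} \<and> c * \<tau> \<in> {0..\<delta>}"
    "ball p \<eta> \<subseteq> ball a \<delta>"
    using small_scale[OF base assms] by metis
  have "0 < e / (M * c + 1)" using e M assms by (simp add: add_nonneg_pos)
  then obtain \<eta>1 where \<eta>1: "0 < \<eta>1" "\<And>u. \<lbrakk>0 \<le> u; u \<le> \<eta>1\<rbrakk> \<Longrightarrow> u powr \<alpha> \<le> e / (M * c + 1)"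
    using ex_powr_le[OF \<alpha>] by metis
  define \<eta>2 where "\<eta>2 = min \<eta> (\<eta>1 / (1 + \<theta>))"
  have "\<eta>2 \<le> \<eta>1 / (1 + \<theta>)" by (simp add: \<eta>2_def)
  then have le: "\<eta>2 + \<theta> * \<eta>2 \<le> \<eta>1" using assms by (simp add: field_simps)
  have "dist (shifted \<theta> c s \<tau> x) (shifted 0 c s \<tau> x) \<le> e * \<tau>"
    if z: "\<tau> \<in> {0<..<\<eta>2}" "s \<in> {s0..<s0+\<eta>2}" "x \<in> ball p \<eta>2" for s \<tau> x
  proof -
    have d: "s \<in> {t..t+\<delta>}" "s + \<theta> * \<tau> \<in> {t..t+\<delta>}" "c * \<tau> \<in> {0..\<delta>}" "x \<in> ball a \<delta>"
      using \<eta>(2)[of \<tau> s] \<eta>(3) z by (auto simp: \<eta>2_def)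
    have "\<theta> * \<tau> \<le> \<theta> * \<eta>2" using z assms by (intro mult_left_mono) auto
    then have "\<theta> * \<tau> \<le> \<eta>1" using le z by auto
    then have p: "(\<theta> * \<tau>) powr \<alpha> \<le> e / (M * c + 1)" using \<eta>1 z assms by simp
    have "dist (shifted \<theta> c s \<tau> x) (shifted 0 c s \<tau> x) \<le> M * (c * \<tau>) * (\<theta> * \<tau>) powr \<alpha>"
      using hoelder[OF d(2,1,4,3)] z assms by (simp add: shifted_def)
    also have "\<dots> \<le> M * (c * \<tau>) * (e / (M * c + 1))" using p M d by (intro mult_left_mono) auto
    also have "\<dots> = (M * c) / (M * c + 1) * (e * \<tau>)" by simp
    also have "\<dots> \<le> 1 * (e * \<tau>)"
      using M assms e z by (intro mult_right_mono) (auto simp: divide_le_eq_1 add_nonneg_pos)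
    finally show ?thesis by simp
  qed
  moreover have "0 < \<eta>2" using \<eta> \<eta>1 assms by (simp add: \<eta>2_def)
  ultimately show "\<exists>\<eta>>0. \<forall>\<tau>\<in>{0<..<\<eta>}. \<forall>s\<in>{s0..<s0+\<eta>}. \<forall>x\<in>ball p \<eta>.
      dist (shifted \<theta> c s \<tau> x) (shifted 0 c s \<tau> x) \<le> e * \<tau>" by blast
qed

text \<open>This is \<open>semigroup_small\<close> with \<open>l = c * \<tau>\<close> and
  \<open>h = \<tau>\<close>. For integer \<open>c\<close> it drives the inductions that take long
  moves apart one unit at a time.\<close>

lemma tangent_add_step:
  assumes "0 \<le> c"
  shows "tangent_at s0 p (shifted 0 (c + 1)) (shifted 0 1 \<odot> shifted 0 c)"
  unfolding tangent_at_def
proof (intro allI impI)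
  fix e :: real assume e: "0 < e"
  obtain \<eta> where \<eta>: "0 < \<eta>" "\<And>s \<tau>. \<lbrakk>\<tau> \<in> {0<..<\<eta>}; s \<in> {s0..<s0+\<eta>}\<rbrakk> \<Longrightarrow> s \<in> {t..t+\<delta>} \<and> s + 0 * \<tau> \<in> {t..t+\<delta>} \<and> c * \<tau> \<in> {0..\<delta>}"
    "ball p \<eta> \<subseteq> ball a \<delta>"
    using small_scale[OF base _ assms, of 0] by auto
  obtain \<eta>1 where \<eta>1: "0 < \<eta>1" "\<And>s x l h. \<lbrakk>s\<in>{t..t+\<delta>}; x\<in>ball a \<delta>; l\<in>{0..<\<eta>1}; h\<in>{0..<\<eta>1}\<rbrakk> \<Longrightarrow>
       dist (\<Phi> s x (l + h)) (\<Phi> s (\<Phi> s x l) h) \<le> e * h"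
    using semigroup_small[OF e] by metis
  define \<eta>2 where "\<eta>2 = min \<eta> (\<eta>1 / (1 + c))"
  have "\<eta>2 \<le> \<eta>1 / (1 + c)" by (simp add: \<eta>2_def)
  then have le: "\<eta>2 + c * \<eta>2 \<le> \<eta>1" using assms by (simp add: field_simps)
  have "dist (shifted 0 (c + 1) s \<tau> x) ((shifted 0 1 \<odot> shifted 0 c) s \<tau> x) \<le> e * \<tau>"
    if z: "\<tau> \<in> {0<..<\<eta>2}" "s \<in> {s0..<s0+\<eta>2}" "x \<in> ball p \<eta>2" for s \<tau> x
  proof -
    have d: "s \<in> {t..t+\<delta>}" "x \<in> ball a \<delta>"
      using \<eta>(2)[of \<tau> s] \<eta>(3) z by (auto simp: \<eta>2_def)
    have "c * \<tau> \<le> c * \<eta>2" "0 \<le> c * \<tau>" "0 \<le> c * \<eta>2" using z assms by (auto intro: mult_left_mono)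
    then have "c * \<tau> \<in> {0..<\<eta>1}" "\<tau> \<in> {0..<\<eta>1}" using le z by auto
    from \<eta>1(2)[OF d this] show ?thesis by (simp add: shifted_def family_comp_def algebra_simps)
  qed
  moreover have "0 < \<eta>2" using \<eta> \<eta>1 assms by (simp add: \<eta>2_def)
  ultimately show "\<exists>\<eta>>0. \<forall>\<tau>\<in>{0<..<\<eta>}. \<forall>s\<in>{s0..<s0+\<eta>}. \<forall>x\<in>ball p \<eta>.
      dist (shifted 0 (c + 1) s \<tau> x) ((shifted 0 1 \<odot> shifted 0 c) s \<tau> x) \<le> e * \<tau>" by blast
qed

end

end

subsection \<open>The one-step map of a pair of arc fields\<close>

text \<open>\<open>commute\<close> is condition D at a single start point, expressed in the duration
  \<tau> = 2 * h.\<close>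

locale arc_pair = Phi: local_arc \<Phi> a t \<delta> M \<alpha> v + Psi: local_arc \<Psi> a t \<delta> M \<alpha> v
  for \<Phi> \<Psi> :: "('a::metric_space) arc_map" and a t \<delta> M \<alpha> v +
  assumes commute: "\<And>s x \<tau>. \<lbrakk>s \<in> {t..t+\<delta>}; x \<in> ball a \<delta>; \<tau> \<in> {0..\<delta>}; s + \<tau> / 2 \<in> {t..t+\<delta>}\<rbrakk> \<Longrightarrow>
    dist (\<Phi> (s + \<tau> / 2) (\<Psi> s x \<tau>) \<tau>) (\<Psi> (s + \<tau> / 2) (\<Phi> s x \<tau>) \<tau>) \<le> M * \<tau> * \<tau> powr \<alpha>"
begin

text \<open>At duration \<open>2 * h\<close> this is the map in the tangency condition of
  \<open>sum_solution_curve\<close>.\<close>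

definition G :: "'a flow_family" where "G s \<tau> x = \<Psi> (s + \<tau> / 2) (\<Phi> s x \<tau>) \<tau>"

section \<open>Moves of the two fields as words modulo first-order agreement\<close>

context
  fixes s0 p assumes base: "s0 \<in> {t..<t+\<delta>}" "p \<in> ball a \<delta>"
begin

abbreviation P :: "nat \<Rightarrow> 'a flow_family" where "P n \<equiv> Phi.shifted 0 (real n)"
abbreviation Q :: "nat \<Rightarrow> 'a flow_family" where "Q n \<equiv> Psi.shifted 0 (real n)"
abbreviation tangent :: "'a flow_family \<Rightarrow> 'a flow_family \<Rightarrow> bool" (infix "\<approx>" 50)
  where "f \<approx> g \<equiv> tangent_at s0 p f g"

lemma tame:
  "\<lbrakk>0 \<le> \<theta>; 0 \<le> c\<rbrakk> \<Longrightarrow> tame_at s0 p (Phi.shifted \<theta> c)"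
  "\<lbrakk>0 \<le> \<theta>; 0 \<le> c\<rbrakk> \<Longrightarrow> tame_at s0 p (Psi.shifted \<theta> c)"
  using Phi.tame_shifted[OF base] Psi.tame_shifted[OF base] by auto

lemmas comp_rules = tangent_at_comp tangent_at_refl tame tame_at_comp

lemma step: "P (Suc n) \<approx> P 1 \<odot> P n" "Q (Suc n) \<approx> Q 1 \<odot> Q n"
  using Phi.tangent_add_step[OF base, of "real n"] Psi.tangent_add_step[OF base, of "real n"]
  by (simp_all add: add.commute)

lemma commute_shifted: "Phi.shifted (1/2) 1 \<odot> Q 1 \<approx> Psi.shifted (1/2) 1 \<odot> P 1"
  unfolding tangent_at_def
proof (intro allI impI)
  fix e :: real assume e: "0 < e"
  obtain \<eta> where \<eta>: "0 < \<eta>" "\<And>s \<tau>. \<lbrakk>\<tau> \<in> {0<..<\<eta>}; s \<in> {s0..<s0+\<eta>}\<rbrakk> \<Longrightarrow>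
      s \<in> {t..t+\<delta>} \<and> s + 1/2 * \<tau> \<in> {t..t+\<delta>} \<and> 1 * \<tau> \<in> {0..\<delta>}" "ball p \<eta> \<subseteq> ball a \<delta>"
    using Phi.small_scale[OF base, of "1/2" 1] by (metis zero_le_one zero_le_divide_1_iff zero_le_numeral)
  have "0 < e / (M + 1)" using e Phi.M by (simp add: add_nonneg_pos)
  then obtain \<eta>1 where \<eta>1: "0 < \<eta>1" "\<And>u. \<lbrakk>0 \<le> u; u \<le> \<eta>1\<rbrakk> \<Longrightarrow> u powr \<alpha> \<le> e / (M + 1)"
    using ex_powr_le[OF Phi.\<alpha>] by metis
  have "dist ((Phi.shifted (1/2) 1 \<odot> Q 1) s \<tau> x) ((Psi.shifted (1/2) 1 \<odot> P 1) s \<tau> x) \<le> e * \<tau>"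
    if z: "\<tau> \<in> {0<..<min \<eta> \<eta>1}" "s \<in> {s0..<s0 + min \<eta> \<eta>1}" "x \<in> ball p (min \<eta> \<eta>1)" for s \<tau> x
  proof -
    have d: "s \<in> {t..t+\<delta>}" "x \<in> ball a \<delta>" "\<tau> \<in> {0..\<delta>}" "s + \<tau> / 2 \<in> {t..t+\<delta>}"
      using \<eta>(2)[of \<tau> s] \<eta>(3) z by auto
    have "dist ((Phi.shifted (1/2) 1 \<odot> Q 1) s \<tau> x) ((Psi.shifted (1/2) 1 \<odot> P 1) s \<tau> x)
        \<le> M * \<tau> * \<tau> powr \<alpha>"
      using commute[OF d] by (simp add: family_comp_def Phi.shifted_def Psi.shifted_def)
    also have "\<dots> \<le> M * \<tau> * (e / (M + 1))" using \<eta>1(2)[of \<tau>] z Phi.M by (intro mult_left_mono) auto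
    also have "\<dots> = M / (M + 1) * (e * \<tau>)" by simp
    also have "\<dots> \<le> 1 * (e * \<tau>)"
      using Phi.M e z by (intro mult_right_mono) (auto simp: divide_le_eq_1)
    finally show ?thesis by simp
  qed
  moreover have "0 < min \<eta> \<eta>1" using \<eta> \<eta>1 by simp
  ultimately show "\<exists>\<eta>>0. \<forall>\<tau>\<in>{0<..<\<eta>}. \<forall>s\<in>{s0..<s0+\<eta>}. \<forall>x\<in>ball p \<eta>.
      dist ((Phi.shifted (1/2) 1 \<odot> Q 1) s \<tau> x) ((Psi.shifted (1/2) 1 \<odot> P 1) s \<tau> x) \<le> e * \<tau>" by blast
qed

text \<open>Condition D exchanges moves of which the second is clocked \<tau>/2 later; condition C
  removes the delay on both sides and leaves a plain commutation law.\<close>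

lemma commute_1: "P 1 \<odot> Q 1 \<approx> Q 1 \<odot> P 1"
proof -
  have "P 1 \<odot> Q 1 \<approx> Phi.shifted (1/2) 1 \<odot> Q 1"
    using Phi.tangent_shifted[OF base, of "1/2" 1] by (intro comp_rules) (auto intro: tangent_at_sym)
  also note commute_shifted
  also have "Psi.shifted (1/2) 1 \<odot> P 1 \<approx> Q 1 \<odot> P 1"
    using Psi.tangent_shifted[OF base, of "1/2" 1] by (intro comp_rules) auto
  finally show ?thesis .
qed

lemma commute_n: "P 1 \<odot> Q (Suc n) \<approx> Q (Suc n) \<odot> P 1"
proof (induction n)
  case 0
  then show ?case using commute_1 by simp
next
  case (Suc n)
  let ?n = "Suc n"
  have "P 1 \<odot> Q (Suc ?n) \<approx> P 1 \<odot> Q 1 \<odot> Q ?n"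
    by (intro comp_rules step) auto
  also have "\<dots> \<approx> (Q 1 \<odot> P 1) \<odot> Q ?n"
    unfolding family_comp_assoc[symmetric] by (intro comp_rules commute_1) auto
  also have "\<dots> = Q 1 \<odot> P 1 \<odot> Q ?n" by (rule family_comp_assoc)
  also have "\<dots> \<approx> Q 1 \<odot> Q ?n \<odot> P 1"
    by (intro comp_rules Suc) auto
  also have "\<dots> = (Q 1 \<odot> Q ?n) \<odot> P 1" by (simp add: family_comp_assoc)
  also have "\<dots> \<approx> Q (Suc ?n) \<odot> P 1"
    by (intro comp_rules tangent_at_sym[OF step(2)]) auto
  finally show ?case .
qed

text \<open>Once a unit is split off both long moves, the word is \<open>Q 1\<close>,
  \<open>Q ?n\<close>, \<open>P 1\<close>, \<open>P ?n\<close>, and only the two middle factors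
  stand in the wrong order.\<close>

lemma product_step: "Q (Suc (Suc n)) \<odot> P (Suc (Suc n)) \<approx> (Q 1 \<odot> P 1) \<odot> (Q (Suc n) \<odot> P (Suc n))"
proof -
  let ?n = "Suc n"
  have "Q (Suc ?n) \<odot> P (Suc ?n) \<approx> (Q 1 \<odot> Q ?n) \<odot> (P 1 \<odot> P ?n)"
    by (intro comp_rules step) auto
  also have "\<dots> = Q 1 \<odot> (Q ?n \<odot> P 1) \<odot> P ?n" by (simp add: family_comp_assoc)
  also have "\<dots> \<approx> Q 1 \<odot> (P 1 \<odot> Q ?n) \<odot> P ?n"
    by (intro comp_rules tangent_at_sym[OF commute_n]) auto
  also have "\<dots> = (Q 1 \<odot> P 1) \<odot> (Q ?n \<odot> P ?n)" by (simp add: family_comp_assoc)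
  finally show ?thesis .
qed

text \<open>Euler step number \<open>k\<close> as a family in the initial time \<open>s\<close>. Its
  delays grow with \<open>k\<close> but are fixed multiples of \<tau>, so all \<open>H k\<close>
  agree to first order with one and the same word.\<close>

definition H :: "nat \<Rightarrow> 'a flow_family" where
  "H k = Psi.shifted (real k + 1/2) 1 \<odot> Phi.shifted (real k) 1"

lemma G_shift: "G (s + real k * \<tau>) \<tau> x = H k s \<tau> x"
  by (simp add: H_def G_def family_comp_def Phi.shifted_def Psi.shifted_def algebra_simps)

lemma H_tangent: "H k \<approx> Q 1 \<odot> P 1"
  unfolding H_def using Phi.tangent_shifted[OF base, of "real k" 1] Psi.tangent_shifted[OF base, of "real k + 1/2" 1]
  by (intro comp_rules) auto

lemma H_tame: "tame_at s0 p (H k)"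
  unfolding H_def by (intro comp_rules) auto

lemma euler_Suc: "(\<lambda>s \<tau> x. euler G \<tau> s x (Suc n)) = H n \<odot> (\<lambda>s \<tau> x. euler G \<tau> s x n)"
  by (simp add: fun_eq_iff family_comp_def G_shift)

lemma euler_tame: "tame_at s0 p (\<lambda>s \<tau> x. euler G \<tau> s x n)"
proof (induction n)
  case 0
  show ?case unfolding tame_at_def by (auto intro!: exI[of _ 1])
next
  case (Suc n)
  then show ?case unfolding euler_Suc by (intro tame_at_comp H_tame)
qed

lemma euler_tangent: "(\<lambda>s \<tau> x. euler G \<tau> s x (Suc n)) \<approx> Q (Suc n) \<odot> P (Suc n)"
proof (induction n)
  case 0
  have "(\<lambda>s \<tau> x. euler G \<tau> s x (Suc 0)) = H 0"
    using G_shift[of _ 0] by (simp add: fun_eq_iff)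
  then show ?case using H_tangent[of 0] by simp
next
  case (Suc n)
  have "(\<lambda>s \<tau> x. euler G \<tau> s x (Suc (Suc n))) \<approx> (Q 1 \<odot> P 1) \<odot> (Q (Suc n) \<odot> P (Suc n))"
    unfolding euler_Suc[of "Suc n"] by (intro tangent_at_comp H_tangent Suc H_tame euler_tame tame_at_comp tame) auto
  also have "\<dots> \<approx> Q (Suc (Suc n)) \<odot> P (Suc (Suc n))" by (rule tangent_at_sym[OF product_step])
  finally show ?case .
qed

lemma G_tangent: "(\<lambda>s \<tau> x. G s (real n * \<tau>) x) \<approx> Q n \<odot> P n"
proof -
  have "(\<lambda>s \<tau> x. G s (real n * \<tau>) x) = Psi.shifted (real n / 2) (real n) \<odot> P n"
    by (simp add: fun_eq_iff G_def family_comp_def Phi.shifted_def Psi.shifted_def)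
  then show ?thesis
    using Psi.tangent_shifted[OF base, of "real n / 2" "real n"] by (auto intro!: comp_rules)
qed

text \<open>Both sides agree to first order with \<open>Q n \<odot> P n\<close>: the single step
  after removal of its half-step delay, the Euler steps by regrouping. For \<open>n = 0\<close> both
  are the identity, since moves of duration zero are.\<close>

lemma consistency: "(\<lambda>s \<tau> x. G s (real n * \<tau>) x) \<approx> (\<lambda>s \<tau> x. euler G \<tau> s x n)"
proof (cases n)
  case 0
  obtain \<eta> where "0 < \<eta>" "\<And>s \<tau>. \<lbrakk>\<tau> \<in> {0<..<\<eta>}; s \<in> {s0..<s0+\<eta>}\<rbrakk> \<Longrightarrow>
      s \<in> {t..t+\<delta>} \<and> s + 0 * \<tau> \<in> {t..t+\<delta>} \<and> 0 * \<tau> \<in> {0..\<delta>}"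
    using Phi.small_scale[OF base order_refl order_refl] by metis
  then show ?thesis using 0 unfolding tangent_at_def
    by (auto simp: G_def Phi.at_0 Psi.at_0 intro!: exI[of _ \<eta>])
next
  case (Suc m)
  show ?thesis unfolding Suc by (rule tangent_at_trans[OF G_tangent tangent_at_sym[OF euler_tangent]])
qed

end

section \<open>Quantitative bounds for the one-step map and its dyadic defect\<close>

text \<open>Small enough that every composition of at most four moves of length at most \<open>D\<close>
  starting in the ball of radius \<open>D\<close> stays in the ball of radius \<open>\<delta>\<close>.\<close>
definition D :: real where "D = \<delta> / (4 * (1 + M))"

lemma D: "0 < D" "4 * D \<le> \<delta>" "D * (1 + 4 * M) \<le> \<delta>" "D \<le> 1"
proof -
  show 1: "0 < D" using Phi.\<delta> Phi.M by (simp add: D_def add_pos_nonneg)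
  have "D * (4 * (1 + M)) = \<delta>" using Phi.M by (simp add: D_def)
  then have eq: "4 * D + 4 * (D * M) = \<delta>" by (simp add: algebra_simps)
  moreover have "0 \<le> D * M" using 1 Phi.M by simp
  ultimately show "4 * D \<le> \<delta>" "D * (1 + 4 * M) \<le> \<delta>" using 1 by (auto simp: algebra_simps)
  then show "D \<le> 1" using Phi.\<delta> 1 by linarith
qed

text \<open>\<open>k\<close> counts travel time in units of \<open>D\<close>, so staying in the ball
  of radius \<delta> becomes addition of small integers, with four units as the limit set by
  \<open>D\<close>.\<close>

definition reach :: "real \<Rightarrow> 'a \<Rightarrow> bool" where "reach k x \<longleftrightarrow> dist a x < D * (1 + k * M)"

lemma reach_ball:
  assumes "reach k x" "k \<le> 4" shows "x \<in> ball a \<delta>"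
proof -
  have "D * (1 + k * M) \<le> D * (1 + 4 * M)"
    using D(1) Phi.M assms(2) by (intro mult_left_mono add_left_mono mult_right_mono) auto
  then show ?thesis using assms(1) D(3) by (simp add: reach_def)
qed

lemma reach_0: "x \<in> ball a D \<Longrightarrow> reach 0 x"
  by (simp add: reach_def)

lemma reach_step:
  assumes "reach k x" "k \<le> 4" "s \<in> {t..t+\<delta>}" "0 \<le> h" "h \<le> j * D" "h \<le> \<delta>"
  shows "reach (k + j) (\<Phi> s x h)" "reach (k + j) (\<Psi> s x h)"
proof -
  have h: "h \<in> {0..\<delta>}" using assms by auto
  have "M * h \<le> M * (j * D)" using assms Phi.M by (intro mult_left_mono)
  then show "reach (k + j) (\<Phi> s x h)" "reach (k + j) (\<Psi> s x h)"
    using Phi.move[OF assms(3) reach_ball[OF assms(1,2)] h] Psi.move[OF assms(3) reach_ball[OF assms(1,2)] h]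
      assms(1) dist_triangle[of a "\<Phi> s x h" x] dist_triangle[of a "\<Psi> s x h" x]
    by (auto simp: reach_def algebra_simps)
qed

lemma lip1:
  assumes "s \<in> {t..t+\<delta>}" "x \<in> ball a \<delta>" "y \<in> ball a \<delta>" "h \<in> {0..\<delta>}"
  shows "dist (\<Phi> s x h) (\<Phi> s y h) \<le> (1 + M) * dist x y" "dist (\<Psi> s x h) (\<Psi> s y h) \<le> (1 + M) * dist x y"
proof -
  have "M * h \<le> M * 1" using assms Phi.\<delta> Phi.M by (intro mult_left_mono) auto
  then have "(1 + M * h) * dist x y \<le> (1 + M) * dist x y" by (intro mult_right_mono) auto
  then show "dist (\<Phi> s x h) (\<Phi> s y h) \<le> (1 + M) * dist x y" "dist (\<Psi> s x h) (\<Psi> s y h) \<le> (1 + M) * dist x y"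
    using Phi.lipschitz[OF assms] Psi.lipschitz[OF assms] by linarith+
qed

lemma hoelder1:
  assumes "s \<in> {t..t+\<delta>}" "s' \<in> {t..t+\<delta>}" "x \<in> ball a \<delta>" "h \<in> {0..\<delta>}" "\<bar>s - s'\<bar> \<le> u"
  shows "dist (\<Phi> s x h) (\<Phi> s' x h) \<le> M * h * u powr \<alpha>" "dist (\<Psi> s x h) (\<Psi> s' x h) \<le> M * h * u powr \<alpha>"
proof -
  have "\<bar>s - s'\<bar> powr \<alpha> \<le> u powr \<alpha>" using assms Phi.\<alpha> by (intro powr_mono2) auto
  then have "M * h * \<bar>s - s'\<bar> powr \<alpha> \<le> M * h * u powr \<alpha>" using assms Phi.M by (intro mult_left_mono) auto
  then show "dist (\<Phi> s x h) (\<Phi> s' x h) \<le> M * h * u powr \<alpha>" "dist (\<Psi> s x h) (\<Psi> s' x h) \<le> M * h * u powr \<alpha>"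
    using Phi.hoelder[OF assms(1-4)] Psi.hoelder[OF assms(1-4)] by linarith+
qed

text \<open>Seven comparisons lead from one step of length \<open>2 * \<tau>\<close> to two of
  length \<tau>. \<open>d1\<close> and \<open>d2\<close> split the moves of \<Phi> and \<Psi> by
  condition B, \<open>d4\<close> exchanges the middle pair by condition D, and the others change
  clocks by condition C. \<open>d3\<close> prepares the exchange: condition D wants the second clock
  at s + \<tau>/2, while the long move of \<Psi> runs at s + \<tau>. \<open>d5\<close> to
  \<open>d7\<close> then set the clocks to those of two short steps.\<close>

lemma G_defect:
  assumes s: "s \<in> {t..t+D}" and x: "x \<in> ball a D" and i: "(1/2)^i \<le> D"
  shows "dist (G s (2 * (1/2)^i) x) (G (s + (1/2)^i) ((1/2)^i) (G s ((1/2)^i) x))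
    \<le> (1/2)^i * ((2 + M) * v i + 5 * M * (1 + M)^2 * ((1/2)^i) powr \<alpha>)"
proof -
  define \<tau> :: real where "\<tau> = (1/2)^i"
  have \<tau>: "0 < \<tau>" "\<tau> \<le> D" using i by (auto simp: \<tau>_def)
  have i\<delta>: "(1/2)^i \<le> \<delta>" using i D by linarith
  have M: "0 \<le> M" using Phi.M .
  have T: "s \<in> {t..t+\<delta>}" "s + \<tau>/2 \<in> {t..t+\<delta>}" "s + \<tau> \<in> {t..t+\<delta>}" "s + \<tau> + \<tau>/2 \<in> {t..t+\<delta>}"
    "\<tau> \<in> {0..\<delta>}" "2 * \<tau> \<in> {0..\<delta>}" using s \<tau> D by auto
  note step1 = reach_step[where h = \<tau> and j = 1, unfolded mult_1]
  define y where "y = \<Phi> s x \<tau>"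
  define u where "u = \<Phi> s x (2 * \<tau>)"
  define z where "z = \<Phi> s y \<tau>"
  define y0 where "y0 = \<Psi> s y \<tau>"
  define y1 where "y1 = \<Psi> (s + \<tau>/2) y \<tau>"
  have rx: "reach 0 x" using x by (rule reach_0)
  have ry: "reach 1 y" unfolding y_def using step1(1)[OF rx _ T(1)] \<tau> T by simp
  have ru: "reach 2 u" unfolding u_def using reach_step(1)[OF rx _ T(1), of "2*\<tau>" 2] \<tau> T by simp
  have rz: "reach 2 z" unfolding z_def using step1(1)[OF ry _ T(1)] \<tau> T by simp
  have ry0: "reach 2 y0" unfolding y0_def using step1(2)[OF ry _ T(1)] \<tau> T by simp
  have ry1: "reach 2 y1" unfolding y1_def using step1(2)[OF ry _ T(2)] \<tau> T by simp
  have r3: "reach 3 (\<Psi> (s + \<tau>) z \<tau>)" "reach 3 (\<Psi> (s + \<tau>/2) z \<tau>)"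
    "reach 3 (\<Phi> (s + \<tau>/2) y0 \<tau>)" "reach 3 (\<Phi> (s + \<tau>/2) y1 \<tau>)" "reach 3 (\<Phi> (s + \<tau>) y1 \<tau>)"
    using step1(2)[OF rz _ T(3)] step1(2)[OF rz _ T(2)] step1(1)[OF ry0 _ T(2)]
      step1(1)[OF ry1 _ T(2)] step1(1)[OF ry1 _ T(3)] \<tau> T by simp_all
  have B: "x \<in> ball a \<delta>" "y \<in> ball a \<delta>" "u \<in> ball a \<delta>" "z \<in> ball a \<delta>" "y0 \<in> ball a \<delta>" "y1 \<in> ball a \<delta>"
    using reach_ball[OF rx] reach_ball[OF ry] reach_ball[OF ru] reach_ball[OF rz]
      reach_ball[OF ry0] reach_ball[OF ry1] by auto
  have B3: "\<Psi> (s + \<tau>) z \<tau> \<in> ball a \<delta>" "\<Psi> (s + \<tau>/2) z \<tau> \<in> ball a \<delta>"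
    "\<Phi> (s + \<tau>/2) y0 \<tau> \<in> ball a \<delta>" "\<Phi> (s + \<tau>/2) y1 \<tau> \<in> ball a \<delta>" "\<Phi> (s + \<tau>) y1 \<tau> \<in> ball a \<delta>"
    using reach_ball[OF r3(1)] reach_ball[OF r3(2)] reach_ball[OF r3(3)] reach_ball[OF r3(4)]
      reach_ball[OF r3(5)] by auto
  define E where "E = M * \<tau> * \<tau> powr \<alpha>"
  define V where "V = \<tau> * v i"
  have E0: "0 \<le> E" using M \<tau> by (simp add: E_def)
  let ?\<Psi> = "\<lambda>q. \<Psi> (s + \<tau>) q \<tau>"
  have d1: "dist (\<Psi> (s + \<tau>) u (2 * \<tau>)) (\<Psi> (s + \<tau>) z (2 * \<tau>)) \<le> (1 + M) * V"
  proof -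
    have "dist u z \<le> V" using Phi.semigroup_dyadic[OF T(1) B(1) i\<delta>]
      by (simp add: u_def z_def y_def \<tau>_def V_def)
    then show ?thesis using lip1(2)[OF T(3) B(3,4) T(6)] M
      by (meson add_nonneg_nonneg mult_left_mono order_trans zero_le_one)
  qed
  have d2: "dist (\<Psi> (s + \<tau>) z (2 * \<tau>)) (?\<Psi> (\<Psi> (s + \<tau>) z \<tau>)) \<le> V"
    using Psi.semigroup_dyadic[OF T(3) B(4) i\<delta>] by (simp add: \<tau>_def V_def)
  have lipE: "dist (?\<Psi> q) (?\<Psi> q') \<le> (1 + M) * b"
    if "q \<in> ball a \<delta>" "q' \<in> ball a \<delta>" "dist q q' \<le> b" for q q' b
    using lip1(2)[OF T(3) that(1,2) T(5)] that(3) M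
    by (meson add_nonneg_nonneg mult_left_mono order_trans zero_le_one)
  have d3: "dist (?\<Psi> (\<Psi> (s + \<tau>) z \<tau>)) (?\<Psi> (\<Psi> (s + \<tau>/2) z \<tau>)) \<le> (1 + M) * E"
    unfolding E_def using \<tau> by (intro lipE B3 hoelder1 T B) auto
  have d4: "dist (?\<Psi> (\<Psi> (s + \<tau>/2) z \<tau>)) (?\<Psi> (\<Phi> (s + \<tau>/2) y0 \<tau>)) \<le> (1 + M) * E"
    using commute[OF T(1) B(2) T(5,2)] by (intro lipE B3) (simp add: E_def z_def y0_def dist_commute)
  have d5: "dist (?\<Psi> (\<Phi> (s + \<tau>/2) y0 \<tau>)) (?\<Psi> (\<Phi> (s + \<tau>/2) y1 \<tau>)) \<le> (1 + M) * ((1 + M) * E)"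
  proof (intro lipE B3)
    have "dist y0 y1 \<le> E" unfolding E_def y0_def y1_def using \<tau> by (intro hoelder1 T B) auto
    then show "dist (\<Phi> (s + \<tau>/2) y0 \<tau>) (\<Phi> (s + \<tau>/2) y1 \<tau>) \<le> (1 + M) * E"
      using lip1(1)[OF T(2) B(5,6) T(5)] M
      by (meson add_nonneg_nonneg mult_left_mono order_trans zero_le_one)
  qed
  have d6: "dist (?\<Psi> (\<Phi> (s + \<tau>/2) y1 \<tau>)) (?\<Psi> (\<Phi> (s + \<tau>) y1 \<tau>)) \<le> (1 + M) * E"
    unfolding E_def using \<tau> by (intro lipE B3 hoelder1 T B) auto
  have d7: "dist (?\<Psi> (\<Phi> (s + \<tau>) y1 \<tau>)) (\<Psi> (s + \<tau> + \<tau>/2) (\<Phi> (s + \<tau>) y1 \<tau>) \<tau>) \<le> E"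
    unfolding E_def using \<tau> by (intro hoelder1 T B3) auto
  \<comment> \<open>The five errors \<open>d3\<close> to \<open>d7\<close> are all rounded up to the
    worst of them, \<open>d5\<close>, which passes through two Lipschitz factors.\<close>
  have "E \<le> (1 + M) * E" using M E0 by (simp add: algebra_simps)
  moreover have "(1 + M) * E \<le> (1 + M) * ((1 + M) * E)"
    using \<open>E \<le> (1 + M) * E\<close> M by (intro mult_left_mono) auto
  ultimately have "dist (\<Psi> (s + \<tau>) u (2 * \<tau>)) (\<Psi> (s + \<tau> + \<tau>/2) (\<Phi> (s + \<tau>) y1 \<tau>) \<tau>)
      \<le> (1 + M) * V + V + 5 * ((1 + M) * ((1 + M) * E))"
    using d1 d2 d3 d4 d5 d6 d7
      dist_triangle[of "\<Psi> (s + \<tau>) u (2 * \<tau>)" "\<Psi> (s + \<tau> + \<tau>/2) (\<Phi> (s + \<tau>) y1 \<tau>) \<tau>" "\<Psi> (s + \<tau>) z (2 * \<tau>)"]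
      dist_triangle[of "\<Psi> (s + \<tau>) z (2 * \<tau>)" "\<Psi> (s + \<tau> + \<tau>/2) (\<Phi> (s + \<tau>) y1 \<tau>) \<tau>" "?\<Psi> (\<Psi> (s + \<tau>) z \<tau>)"]
      dist_triangle[of "?\<Psi> (\<Psi> (s + \<tau>) z \<tau>)" "\<Psi> (s + \<tau> + \<tau>/2) (\<Phi> (s + \<tau>) y1 \<tau>) \<tau>" "?\<Psi> (\<Psi> (s + \<tau>/2) z \<tau>)"]
      dist_triangle[of "?\<Psi> (\<Psi> (s + \<tau>/2) z \<tau>)" "\<Psi> (s + \<tau> + \<tau>/2) (\<Phi> (s + \<tau>) y1 \<tau>) \<tau>" "?\<Psi> (\<Phi> (s + \<tau>/2) y0 \<tau>)"]
      dist_triangle[of "?\<Psi> (\<Phi> (s + \<tau>/2) y0 \<tau>)" "\<Psi> (s + \<tau> + \<tau>/2) (\<Phi> (s + \<tau>) y1 \<tau>) \<tau>" "?\<Psi> (\<Phi> (s + \<tau>/2) y1 \<tau>)"]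
      dist_triangle[of "?\<Psi> (\<Phi> (s + \<tau>/2) y1 \<tau>)" "\<Psi> (s + \<tau> + \<tau>/2) (\<Phi> (s + \<tau>) y1 \<tau>) \<tau>" "?\<Psi> (\<Phi> (s + \<tau>) y1 \<tau>)"]
    by linarith
  also have "\<dots> = \<tau> * ((2 + M) * v i + 5 * M * (1 + M)^2 * \<tau> powr \<alpha>)"
    by (simp add: V_def E_def algebra_simps power2_eq_square)
  finally show ?thesis by (simp add: G_def u_def y1_def y_def \<tau>_def)
qed

lemma G_regular:
  assumes "s \<in> {t..t+D}" "s' \<in> {t..t+D}" "\<tau> \<in> {0..D}" "\<tau>' \<in> {0..D}" "x \<in> ball a D"
    "\<bar>s - s'\<bar> \<le> \<eta>" "\<bar>\<tau> - \<tau>'\<bar> \<le> \<eta>"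
  shows "dist (G s \<tau> x) (G s' \<tau>' x) \<le> (2 + M) * M * \<bar>\<tau> - \<tau>'\<bar> + (2 + M) * M * (2 * \<eta>) powr \<alpha> * \<tau>"
proof -
  have M: "0 \<le> M" using Phi.M .
  have T: "s \<in> {t..t+\<delta>}" "s + \<tau>/2 \<in> {t..t+\<delta>}" "s' \<in> {t..t+\<delta>}" "s' + \<tau>'/2 \<in> {t..t+\<delta>}"
    "\<tau> \<in> {0..\<delta>}" "\<tau>' \<in> {0..\<delta>}" using assms D by auto
  have rx: "reach 0 x" using assms(5) by (rule reach_0)
  have "reach 1 (\<Phi> s x \<tau>)" "reach 1 (\<Phi> s' x \<tau>)" "reach 1 (\<Phi> s' x \<tau>')"
    using reach_step(1)[OF rx, where j = 1] assms T by auto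
  then have B: "x \<in> ball a \<delta>" "\<Phi> s x \<tau> \<in> ball a \<delta>" "\<Phi> s' x \<tau> \<in> ball a \<delta>" "\<Phi> s' x \<tau>' \<in> ball a \<delta>"
    using reach_ball reach_ball[OF rx] by auto
  \<comment> \<open>The clocks of \<Phi> differ by at most \<eta>, those of \<Psi> by at most 3/2 *
    \<eta>; \<open>2 * \<eta>\<close> covers both.\<close>
  define A where "A = (2 * \<eta>) powr \<alpha>"
  have mono: "(1 + M) * c \<le> (1 + M) * c'" if "c \<le> c'" for c c' using that M by (intro mult_left_mono) auto
  have "dist (\<Phi> s x \<tau>) (\<Phi> s' x \<tau>) \<le> M * \<tau> * A"
    unfolding A_def using assms by (intro hoelder1 T B) auto
  then have 1: "dist (\<Psi> (s + \<tau>/2) (\<Phi> s x \<tau>) \<tau>) (\<Psi> (s + \<tau>/2) (\<Phi> s' x \<tau>) \<tau>) \<le> (1 + M) * (M * \<tau> * A)"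
    using lip1(2)[OF T(2) B(2,3) T(5)] mono order_trans by blast
  have "dist (\<Phi> s' x \<tau>) (\<Phi> s' x \<tau>') \<le> M * \<bar>\<tau> - \<tau>'\<bar>" by (intro Phi.speed T B)
  then have 2: "dist (\<Psi> (s + \<tau>/2) (\<Phi> s' x \<tau>) \<tau>) (\<Psi> (s + \<tau>/2) (\<Phi> s' x \<tau>') \<tau>) \<le> (1 + M) * (M * \<bar>\<tau> - \<tau>'\<bar>)"
    using lip1(2)[OF T(2) B(3,4) T(5)] mono order_trans by blast
  have 3: "dist (\<Psi> (s + \<tau>/2) (\<Phi> s' x \<tau>') \<tau>) (\<Psi> (s' + \<tau>'/2) (\<Phi> s' x \<tau>') \<tau>) \<le> M * \<tau> * A"
    unfolding A_def using assms by (intro hoelder1 T B) auto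
  have 4: "dist (\<Psi> (s' + \<tau>'/2) (\<Phi> s' x \<tau>') \<tau>) (\<Psi> (s' + \<tau>'/2) (\<Phi> s' x \<tau>') \<tau>') \<le> M * \<bar>\<tau> - \<tau>'\<bar>"
    by (intro Psi.speed T B)
  have "dist (\<Psi> (s + \<tau>/2) (\<Phi> s x \<tau>) \<tau>) (\<Psi> (s' + \<tau>'/2) (\<Phi> s' x \<tau>') \<tau>')
     \<le> (1 + M) * (M * \<tau> * A) + (1 + M) * (M * \<bar>\<tau> - \<tau>'\<bar>) + M * \<tau> * A + M * \<bar>\<tau> - \<tau>'\<bar>"
    using 1 2 3 4
      dist_triangle[of "\<Psi> (s + \<tau>/2) (\<Phi> s x \<tau>) \<tau>" "\<Psi> (s' + \<tau>'/2) (\<Phi> s' x \<tau>') \<tau>'" "\<Psi> (s + \<tau>/2) (\<Phi> s' x \<tau>) \<tau>"]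
      dist_triangle[of "\<Psi> (s + \<tau>/2) (\<Phi> s' x \<tau>) \<tau>" "\<Psi> (s' + \<tau>'/2) (\<Phi> s' x \<tau>') \<tau>'" "\<Psi> (s + \<tau>/2) (\<Phi> s' x \<tau>') \<tau>"]
      dist_triangle[of "\<Psi> (s + \<tau>/2) (\<Phi> s' x \<tau>') \<tau>" "\<Psi> (s' + \<tau>'/2) (\<Phi> s' x \<tau>') \<tau>'" "\<Psi> (s' + \<tau>'/2) (\<Phi> s' x \<tau>') \<tau>"]
    by linarith
  also have "\<dots> = (2 + M) * M * \<bar>\<tau> - \<tau>'\<bar> + (2 + M) * M * A * \<tau>" by (simp add: algebra_simps)
  finally show ?thesis by (simp add: G_def A_def)
qed

lemma summable_half_powr: "summable (\<lambda>i::nat. ((1/2)^i) powr \<alpha> :: real)"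
proof -
  have "((1/2::real)^i) powr \<alpha> = ((1/2) powr \<alpha>)^i" for i
    by (simp add: powr_power powr_powr powr_realpow[symmetric] mult.commute)
  moreover have "(1/2::real) powr \<alpha> < 1" using Phi.\<alpha> by (simp add: powr_def ln_div)
  ultimately show ?thesis by (simp add: summable_geometric)
qed

text \<open>The constant \<open>(2 + M) * M\<close>, which is \<open>(1 + M)^2 - 1\<close>, serves
  three bounds: the speed of two moves is at most \<open>2 * M\<close>, two factors
  \<open>1 + M * \<tau>\<close> with \<tau> at most 1 multiply to at most
  \<open>1 + (2 + M) * M * \<tau>\<close>, and \<open>G_regular\<close> has it as the coefficient of
  a change of duration.\<close>

lemma scheme:
  assumes "complete U" "ball a \<delta> \<subseteq> U"
  shows "evolution_scheme G a t D ((2 + M) * M) ((2 + M) * M)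
    (\<lambda>i. (2 + M) * v i + 5 * M * (1 + M)^2 * ((1/2)^i) powr \<alpha>) U"
proof
  have M: "0 \<le> M" using Phi.M .
  have D\<delta>: "D \<le> \<delta>" using D by linarith
  have ball_D: "x \<in> ball a \<delta>" if "x \<in> ball a D" for x using that D\<delta> by auto
  show "0 < D" "0 \<le> (2 + M) * M" "complete U" using D M assms by auto
  show "ball a D \<subseteq> U" using assms ball_D by blast
  show "0 \<le> (2 + M) * v i + 5 * M * (1 + M)^2 * ((1/2)^i) powr \<alpha>" for i
    using M Phi.v(1)[of i] by simp
  show "summable (\<lambda>i. (2 + M) * v i + 5 * M * (1 + M)^2 * ((1/2)^i) powr \<alpha>)"
    by (intro summable_add summable_mult Phi.v(2) summable_half_powr)
  have T: "s \<in> {t..t+\<delta>}" "s + \<tau>/2 \<in> {t..t+\<delta>}" "\<tau> \<in> {0..\<delta>}" if "s \<in> {t..t+D}" "\<tau> \<in> {0..D}" for s \<tau>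
    using that D by auto
  have \<Phi>_ball: "\<Phi> s x \<tau> \<in> ball a \<delta>" if "s \<in> {t..t+D}" "\<tau> \<in> {0..D}" "x \<in> ball a D" for s \<tau> x
    using reach_ball[OF reach_step(1)[OF reach_0[OF that(3)], of s \<tau> 1]] T[OF that(1,2)] that by auto
  show "dist x (G s \<tau> x) \<le> (2 + M) * M * \<tau>"
    if "s \<in> {t..t+D}" "x \<in> ball a D" "\<tau> \<in> {0..D}" for s x \<tau>
  proof -
    have "dist x (\<Phi> s x \<tau>) \<le> M * \<tau>" using T[OF that(1,3)] ball_D that by (intro Phi.move)
    moreover have "dist (\<Phi> s x \<tau>) (G s \<tau> x) \<le> M * \<tau>"
      unfolding G_def using T[OF that(1,3)] \<Phi>_ball that by (intro Psi.move)
    moreover have "0 \<le> M * M * \<tau>" using M that by simp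
    ultimately show ?thesis using dist_triangle[of x "G s \<tau> x" "\<Phi> s x \<tau>"] by (simp add: algebra_simps)
  qed
  show "dist (G s \<tau> x) (G s \<tau> y) \<le> (1 + (2 + M) * M * \<tau>) * dist x y"
    if "s \<in> {t..t+D}" "x \<in> ball a D" "y \<in> ball a D" "\<tau> \<in> {0..D}" for s x y \<tau>
  proof -
    note T' = T[OF that(1,4)]
    have "dist (\<Phi> s x \<tau>) (\<Phi> s y \<tau>) \<le> (1 + M * \<tau>) * dist x y"
      using T' ball_D that by (intro Phi.lipschitz)
    then have "(1 + M * \<tau>) * dist (\<Phi> s x \<tau>) (\<Phi> s y \<tau>) \<le> (1 + M * \<tau>) * ((1 + M * \<tau>) * dist x y)"
      using M that by (intro mult_left_mono) auto
    moreover have "dist (G s \<tau> x) (G s \<tau> y) \<le> (1 + M * \<tau>) * dist (\<Phi> s x \<tau>) (\<Phi> s y \<tau>)"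
      unfolding G_def using T' \<Phi>_ball that by (intro Psi.lipschitz)
    moreover have "(1 + M * \<tau>) * (1 + M * \<tau>) \<le> 1 + (2 + M) * M * \<tau>"
    proof -
      have "(M * \<tau>) * (M * \<tau>) \<le> (M * \<tau>) * M"
        using M that D by (intro mult_left_mono) (auto simp: mult_left_le)
      then show ?thesis by (simp add: algebra_simps)
    qed
    then have "(1 + M * \<tau>) * (1 + M * \<tau>) * dist x y \<le> (1 + (2 + M) * M * \<tau>) * dist x y"
      by (intro mult_right_mono) auto
    ultimately show ?thesis by (simp add: mult.assoc)
  qed
  show "dist (G s (2 * (1/2)^i) x) (G (s + (1/2)^i) ((1/2)^i) (G s ((1/2)^i) x))
      \<le> (1/2)^i * ((2 + M) * v i + 5 * M * (1 + M)^2 * ((1/2)^i) powr \<alpha>)"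
    if "s \<in> {t..t+D}" "x \<in> ball a D" "(1/2)^i \<le> D" for s x i
    using G_defect[OF that] .
  show "\<exists>\<eta>>0. \<forall>\<tau>\<in>{0<..<\<eta>}. \<forall>s\<in>{s0..<s0+\<eta>}. \<forall>x\<in>ball p \<eta>.
      dist (G s (real N * \<tau>) x) (euler G \<tau> s x N) \<le> e * \<tau>"
    if "s0 \<in> {t..<t+D}" "p \<in> ball a D" "0 < e" for s0 p N e
  proof -
    have "s0 \<in> {t..<t+\<delta>}" "p \<in> ball a \<delta>" using that D\<delta> ball_D by auto
    from consistency[OF this, of N] show ?thesis using that(3) unfolding tangent_at_def by blast
  qed
  show "\<exists>\<eta>>0. \<forall>s\<in>{t..t+D}. \<forall>s'\<in>{t..t+D}. \<forall>\<tau>\<in>{0..D}. \<forall>\<tau>'\<in>{0..D}. \<forall>x\<in>ball a D.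
      \<bar>s - s'\<bar> \<le> \<eta> \<longrightarrow> \<bar>\<tau> - \<tau>'\<bar> \<le> \<eta> \<longrightarrow>
      dist (G s \<tau> x) (G s' \<tau>' x) \<le> (2 + M) * M * \<bar>\<tau> - \<tau>'\<bar> + e * \<tau>" if e: "0 < e" for e
  proof -
    define B where "B = (2 + M) * M"
    have B: "0 \<le> B" using M by (simp add: B_def)
    then have "0 < e / (B + 1)" using e by (simp add: add_nonneg_pos)
    then obtain \<eta> where \<eta>: "0 < \<eta>" "\<And>u. \<lbrakk>0 \<le> u; u \<le> \<eta>\<rbrakk> \<Longrightarrow> u powr \<alpha> \<le> e / (B + 1)"
      using ex_powr_le[OF Phi.\<alpha>] by metis
    have "B * (2 * (\<eta>/2)) powr \<alpha> \<le> B * (e / (B + 1))" using \<eta> B by (intro mult_left_mono) auto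
    also have "\<dots> \<le> e" using B e by (simp add: field_simps)
    finally have le: "B * (2 * (\<eta>/2)) powr \<alpha> * \<tau> \<le> e * \<tau>" if "0 \<le> \<tau>" for \<tau>
      using that by (intro mult_right_mono)
    have "dist (G s \<tau> x) (G s' \<tau>' x) \<le> (2 + M) * M * \<bar>\<tau> - \<tau>'\<bar> + e * \<tau>"
      if "s \<in> {t..t+D}" "s' \<in> {t..t+D}" "\<tau> \<in> {0..D}" "\<tau>' \<in> {0..D}" "x \<in> ball a D"
        "\<bar>s - s'\<bar> \<le> \<eta>/2" "\<bar>\<tau> - \<tau>'\<bar> \<le> \<eta>/2" for s s' \<tau> \<tau>' x
      using G_regular[OF that] le[of \<tau>] that(3) unfolding B_def by auto
    then show ?thesis using \<eta>(1) by (intro exI[of _ "\<eta>/2"]) auto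
  qed
qed

end

subsection \<open>Local constants from the conditions\<close>

lemma arc_field_speed:
  fixes \<Phi> :: "('a::metric_space) arc_map"
  assumes "time_dependent_arc_field \<Phi>" "0 \<le> t"
  obtains \<delta> M where "0 < \<delta>" "0 \<le> M"
    "\<And>s x h k. \<lbrakk>s \<in> {t..t+\<delta>}; x \<in> ball a \<delta>; h \<in> {0..1}; k \<in> {0..1}\<rbrakk> \<Longrightarrow> dist (\<Phi> s x h) (\<Phi> s x k) \<le> M * \<bar>h - k\<bar>"
proof -
  obtain r l where rl: "0 < r" "0 < l" and fin: "local_arc_speed \<Phi> a t r l < \<infinity>"
    using assms unfolding time_dependent_arc_field_def by blast
  define \<delta> where "\<delta> = min r l"
  define M where "M = max 0 (real_of_ereal (local_arc_speed \<Phi> a t r l))"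
  have "dist (\<Phi> s x h) (\<Phi> s x k) \<le> M * \<bar>h - k\<bar>"
    if "s \<in> {t..t+\<delta>}" "x \<in> ball a \<delta>" "h \<in> {0..1}" "k \<in> {0..1}" for s x h k
  proof (cases "h = k")
    case False
    have "ereal (dist (\<Phi> s x h) (\<Phi> s x k) / \<bar>h - k\<bar>) \<le> arc_speed \<Phi> x s"
      unfolding arc_speed_def using that False by (intro SUP_upper2[of "(h, k)"]) auto
    also have "\<dots> \<le> local_arc_speed \<Phi> a t r l"
      unfolding local_arc_speed_def using that rl assms(2)
      by (intro SUP_upper2[of "(x, s)"]) (auto simp: \<delta>_def)
    finally have le: "ereal (dist (\<Phi> s x h) (\<Phi> s x k) / \<bar>h - k\<bar>) \<le> local_arc_speed \<Phi> a t r l" .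
    then have "dist (\<Phi> s x h) (\<Phi> s x k) / \<bar>h - k\<bar> \<le> M"
      using fin by (cases "local_arc_speed \<Phi> a t r l") (auto simp: M_def)
    then show ?thesis using False by (simp add: divide_le_eq)
  qed simp
  then show ?thesis using that[of \<delta> M] rl by (simp add: \<delta>_def M_def)
qed

lemma condition_A_local:
  fixes \<Phi> :: "('a::metric_space) arc_map"
  assumes "condition_A \<Phi>" "0 \<le> t"
  obtains \<delta> M where "0 < \<delta>" "0 \<le> M"
    "\<And>s x y h. \<lbrakk>s \<in> {t..t+\<delta>}; x \<in> ball a \<delta>; y \<in> ball a \<delta>; h \<in> {0..\<delta>}\<rbrakk>
      \<Longrightarrow> dist (\<Phi> s x h) (\<Phi> s y h) \<le> (1 + M * h) * dist x y"
proof -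
  obtain \<Lambda> :: "'a \<Rightarrow> 'a \<Rightarrow> real \<Rightarrow> real" and r \<epsilon> T where rl: "0 < r" "\<epsilon> \<in> {0<..1}" "t < T"
    and bdd: "bdd_above ((\<lambda>(x, y, h). \<Lambda> x y h) ` (ball a r \<times> ball a r \<times> {0..\<epsilon>}))"
    and le: "\<forall>a1\<in>ball a r. \<forall>a2\<in>ball a r. \<forall>h\<in>{0..\<epsilon>}. \<forall>s\<in>{t..T}.
             dist (\<Phi> s a1 h) (\<Phi> s a2 h) \<le> dist a1 a2 * (1 + h * \<Lambda> a1 a2 h)"
    by (insert assms(1)[unfolded condition_A_def], elim exE, drule spec[of _ a], drule spec[of _ t],
        drule mp[OF _ assms(2)], elim exE bexE conjE, rule that)
  obtain M0 where M0: "\<And>x y h. \<lbrakk>x \<in> ball a r; y \<in> ball a r; h \<in> {0..\<epsilon>}\<rbrakk> \<Longrightarrow> \<Lambda> x y h \<le> M0"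
    using bdd unfolding bdd_above_def by fastforce
  define \<delta> where "\<delta> = Min {r, \<epsilon>, T - t}"
  \<comment> \<open>The upper bound for \<Lambda> may be negative; \<open>max 0\<close> turns it
    into a growth rate.\<close>
  define M where "M = max 0 M0"
  have "0 < \<delta>" using rl by (auto simp: \<delta>_def)
  have \<delta>: "\<delta> \<le> r" "\<delta> \<le> \<epsilon>" "\<delta> \<le> T - t" unfolding \<delta>_def by (rule Min_le; simp)+
  have "dist (\<Phi> s x h) (\<Phi> s y h) \<le> (1 + M * h) * dist x y"
    if "s \<in> {t..t+\<delta>}" "x \<in> ball a \<delta>" "y \<in> ball a \<delta>" "h \<in> {0..\<delta>}" for s x y h
  proof -
    have z: "x \<in> ball a r" "y \<in> ball a r" "h \<in> {0..\<epsilon>}" "s \<in> {t..T}" using that \<delta> by auto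
    have "h * \<Lambda> x y h \<le> h * M" using M0[OF z(1-3)] that by (intro mult_left_mono) (auto simp: M_def)
    then have "dist x y * (1 + h * \<Lambda> x y h) \<le> dist x y * (1 + h * M)" by (intro mult_left_mono) auto
    then show ?thesis using le[rule_format, OF z] by (simp add: mult.commute)
  qed
  then show ?thesis using that[of \<delta> M] \<open>0 < \<delta>\<close> by (simp add: M_def)
qed

lemma condition_B_local:
  fixes \<Phi> :: "('a::metric_space) arc_map"
  assumes "condition_B \<Phi>" "time_dependent_arc_field \<Phi>" "0 \<le> t"
  obtains \<delta> v where "0 < \<delta>" "\<And>i::nat. 0 \<le> v i" "summable v"
    "\<And>s x i. \<lbrakk>s \<in> {t..t+\<delta>}; x \<in> ball a \<delta>; (1/2)^i \<le> \<delta>\<rbrakk>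
       \<Longrightarrow> dist (\<Phi> s x (2 * (1/2)^i)) (\<Phi> s (\<Phi> s x ((1/2)^i)) ((1/2)^i)) \<le> (1/2)^i * v i"
    "\<And>e. 0 < e \<Longrightarrow> \<exists>\<eta>>0. \<forall>s\<in>{t..t+\<delta>}. \<forall>x\<in>ball a \<delta>. \<forall>l\<in>{0..<\<eta>}. \<forall>h\<in>{0..<\<eta>}.
       dist (\<Phi> s x (l + h)) (\<Phi> s (\<Phi> s x l) h) \<le> e * h"
proof -
  obtain \<Omega> :: "'a \<Rightarrow> real \<Rightarrow> real \<Rightarrow> real" and r \<epsilon> T g where
    "\<forall>b. \<forall>l\<in>{0..1}. \<forall>h\<in>{0..1}. \<Omega> b l h \<ge> 0"
    and rl: "0 < r" "\<epsilon> \<in> {0<..1}" "t < T"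
    and bdd: "bounded ((\<lambda>(b, l, h). \<Omega> b l h) ` (ball a r \<times> {0..\<epsilon>} \<times> {0..\<epsilon>}))"
    and g: "\<forall>l\<in>{0..\<epsilon>}. \<forall>h\<in>{0..\<epsilon>}. (g l h :: real) \<ge> 0"
    and lim: "((\<lambda>(l, h). g l h) \<longlongrightarrow> 0) (at_right 0 \<times>\<^sub>F at_right 0)"
    and sum: "(\<lambda>i. g ((1/2) ^ i) ((1/2) ^ i)) summable_on {i::nat. i \<ge> 1 \<and> (1/2) ^ i \<le> \<epsilon>}"
    and le: "\<forall>b\<in>ball a r. \<forall>l\<in>{0..\<epsilon>}. \<forall>h\<in>{0..\<epsilon>}. \<forall>s\<in>{t..T}. l + h \<le> 1 \<longrightarrow>
                 dist (\<Phi> s b (l + h)) (\<Phi> s (\<Phi> s b l) h) \<le> h * g l h * \<Omega> b l h"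
    by (insert assms(1)[unfolded condition_B_def], elim exE conjE, drule spec[of _ a], drule spec[of _ t],
        drule mp[OF _ assms(3)], elim exE bexE conjE, rule that)
  obtain W0 where W0: "\<And>x l h. \<lbrakk>x \<in> ball a r; l \<in> {0..\<epsilon>}; h \<in> {0..\<epsilon>}\<rbrakk> \<Longrightarrow> \<bar>\<Omega> x l h\<bar> \<le> W0"
    using bdd unfolding bounded_iff by fastforce
  define W where "W = max 0 W0"
  have W: "0 \<le> W" by (simp add: W_def)
  have bound: "dist (\<Phi> s b (l + h)) (\<Phi> s (\<Phi> s b l) h) \<le> h * (g l h * W)"
    if "b\<in>ball a r" "l\<in>{0..\<epsilon>}" "h\<in>{0..\<epsilon>}" "s\<in>{t..T}" "l + h \<le> 1" for b l h s
  proof -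
    have "h * g l h * \<Omega> b l h \<le> h * g l h * W"
      using W0[OF that(1-3)] g that by (intro mult_left_mono) (auto simp: W_def)
    then show ?thesis using le[rule_format, OF that] by (simp add: mult.assoc)
  qed
  \<comment> \<open>\<open>\<epsilon> / 2\<close> yields \<delta> at most 1/2. A dyadic step of size
    at most \<delta> then has exponent at least 1, as the summation set demands, and twice that step
    is at most 1.\<close>
  define \<delta> where "\<delta> = Min {r, \<epsilon> / 2, T - t}"
  have "0 < \<delta>" using rl by (auto simp: \<delta>_def)
  have "\<delta> \<le> r" "\<delta> \<le> \<epsilon> / 2" "\<delta> \<le> T - t" unfolding \<delta>_def by (rule Min_le; simp)+
  then have \<delta>: "\<delta> \<le> r" "\<delta> \<le> \<epsilon>" "\<delta> \<le> 1/2" "\<delta> \<le> T - t" using rl by auto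
  define S where "S = {i::nat. i \<ge> 1 \<and> (1/2) ^ i \<le> \<epsilon>}"
  define v where "v i = (if i \<in> S then g ((1/2) ^ i) ((1/2) ^ i) * W else 0)" for i
  have v0: "0 \<le> v i" for i using g W by (auto simp: v_def S_def)
  have "(\<lambda>i. g ((1/2) ^ i) ((1/2) ^ i) * W) summable_on S"
    using sum unfolding S_def by (rule summable_on_cmult_left)
  also have "?this \<longleftrightarrow> v summable_on UNIV"
    by (rule summable_on_cong_neutral) (auto simp: v_def)
  finally have v1: "summable v" by (rule summable_on_imp_summable)
  have v2: "dist (\<Phi> s x (2 * (1/2)^i)) (\<Phi> s (\<Phi> s x ((1/2)^i)) ((1/2)^i)) \<le> (1/2)^i * v i"
    if "s \<in> {t..t+\<delta>}" "x \<in> ball a \<delta>" "(1/2)^i \<le> \<delta>" for s x i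
  proof -
    have "i \<noteq> 0" using that(3) \<delta> by (cases "i = 0") auto
    then have "i \<in> S" using that(3) \<delta> by (auto simp: S_def)
    moreover have "dist (\<Phi> s x ((1/2)^i + (1/2)^i)) (\<Phi> s (\<Phi> s x ((1/2)^i)) ((1/2)^i))
        \<le> (1/2)^i * (g ((1/2)^i) ((1/2)^i) * W)"
    proof (rule bound)
      show "x \<in> ball a r" "s \<in> {t..T}" using that(1,2) \<delta> by auto
      have "0 \<le> (1/2::real)^i" by simp
      then show "(1/2)^i \<in> {0..\<epsilon>}" "(1/2)^i \<in> {0..\<epsilon>}" "(1/2)^i + (1/2::real)^i \<le> 1"
        using that(3) \<delta> unfolding atLeastAtMost_iff by linarith+
    qed
    moreover have "(1/2)^i + (1/2)^i = 2 * (1/2::real)^i" by (rule mult_2[symmetric])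
    ultimately show ?thesis by (simp only: v_def if_True)
  qed
  have id: "\<Phi> s x 0 = x" if "s \<in> {t..t+\<delta>}" for s x
    using assms(2,3) that unfolding time_dependent_arc_field_def by auto
  have v3: "\<exists>\<eta>>0. \<forall>s\<in>{t..t+\<delta>}. \<forall>x\<in>ball a \<delta>. \<forall>l\<in>{0..<\<eta>}. \<forall>h\<in>{0..<\<eta>}.
       dist (\<Phi> s x (l + h)) (\<Phi> s (\<Phi> s x l) h) \<le> e * h" if e: "0 < e" for e
  proof -
    have "0 < e / (W + 1)" using e W by (simp add: add_nonneg_pos)
    then have "\<forall>\<^sub>F z in at_right 0 \<times>\<^sub>F at_right 0. dist ((\<lambda>(l, h). g l h) z) 0 < e / (W + 1)"
      using lim by (rule tendstoD[rotated])
    then obtain P Q where "eventually P (at_right 0)" "eventually Q (at_right 0)"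
      and PQ: "\<And>l h. \<lbrakk>P l; Q h\<rbrakk> \<Longrightarrow> \<bar>g l h\<bar> < e / (W + 1)"
      unfolding eventually_prod_filter by auto
    then obtain b1 b2 where b: "0 < b1" "0 < b2" "\<And>l. \<lbrakk>0 < l; l < b1\<rbrakk> \<Longrightarrow> P l" "\<And>h. \<lbrakk>0 < h; h < b2\<rbrakk> \<Longrightarrow> Q h"
      unfolding eventually_at_right_field by auto
    define \<eta> where "\<eta> = Min {b1, b2, \<delta>}"
    have "0 < \<eta>" using b \<open>0 < \<delta>\<close> by (auto simp: \<eta>_def)
    have \<eta>: "\<eta> \<le> b1" "\<eta> \<le> b2" "\<eta> \<le> \<delta>" unfolding \<eta>_def by (rule Min_le; simp)+
    have "dist (\<Phi> s x (l + h)) (\<Phi> s (\<Phi> s x l) h) \<le> e * h"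
      if z: "s \<in> {t..t+\<delta>}" "x \<in> ball a \<delta>" "l \<in> {0..<\<eta>}" "h \<in> {0..<\<eta>}" for s x l h
    proof (cases "l = 0 \<or> h = 0")
      \<comment> \<open>The limit concerns positive \<open>l\<close> and \<open>h\<close> only; when
        a duration is zero, the two points coincide because \<open>\<Phi> s x 0 = x\<close>.\<close>
      case True
      then show ?thesis using z e by (auto simp: id[OF z(1)])
    next
      case False
      then have "\<bar>g l h\<bar> < e / (W + 1)" using z \<eta> by (intro PQ b) auto
      then have "g l h * W \<le> e / (W + 1) * W" using W by (intro mult_right_mono) auto
      also have "\<dots> \<le> e" using W e by (simp add: field_simps)
      finally have "h * (g l h * W) \<le> h * e" using z by (intro mult_left_mono) auto
      moreover have "dist (\<Phi> s x (l + h)) (\<Phi> s (\<Phi> s x l) h) \<le> h * (g l h * W)"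
        using z \<eta> \<delta> by (intro bound) auto
      ultimately show ?thesis by (simp add: mult.commute)
    qed
    with \<open>0 < \<eta>\<close> show ?thesis by blast
  qed
  show ?thesis using that[of \<delta> v] \<open>0 < \<delta>\<close> v0 v1 v2 v3 by blast
qed

lemma condition_C_local:
  fixes \<Phi> :: "('a::metric_space) arc_map"
  assumes "condition_C \<Phi>" "0 \<le> t"
  obtains \<delta> \<alpha> C where "0 < \<delta>" "0 < \<alpha>" "0 \<le> C"
    "\<And>s s' x h. \<lbrakk>s \<in> {t..t+\<delta>}; s' \<in> {t..t+\<delta>}; x \<in> ball a \<delta>; h \<in> {0..\<delta>}\<rbrakk>
       \<Longrightarrow> dist (\<Phi> s x h) (\<Phi> s' x h) \<le> C * h * \<bar>s - s'\<bar> powr \<alpha>"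
proof -
  obtain r \<epsilon> T \<alpha> C where rl: "0 < r" "\<epsilon> \<in> {0<..1}" "t < T" "\<alpha> \<in> {0<..<1}" "0 < C"
    and le: "\<forall>b\<in>ball a r. \<forall>h\<in>{0..\<epsilon>}. \<forall>s1\<in>{t..T}. \<forall>s2\<in>{t..T}.
          dist (\<Phi> s1 b h) (\<Phi> s2 b h) \<le> C * h * \<bar>s1 - s2\<bar> powr \<alpha>"
    by (insert assms(1)[unfolded condition_C_def], drule spec[of _ a], drule spec[of _ t],
        drule mp[OF _ assms(2)], elim exE bexE conjE, rule that)
  define \<delta> where "\<delta> = Min {r, \<epsilon>, T - t}"
  have "0 < \<delta>" using rl by (auto simp: \<delta>_def)
  have \<delta>: "\<delta> \<le> r" "\<delta> \<le> \<epsilon>" "\<delta> \<le> T - t" unfolding \<delta>_def by (rule Min_le; simp)+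
  show ?thesis
    by (rule that[of \<delta> \<alpha> C]) (use \<open>0 < \<delta>\<close> rl \<delta> in \<open>auto intro!: le[rule_format]\<close>)
qed

lemma condition_D_local:
  fixes \<Phi> \<Psi> :: "('a::metric_space) arc_map"
  assumes "condition_D \<Phi> \<Psi>" "0 \<le> t"
  obtains \<delta> \<alpha> C where "0 < \<delta>" "0 < \<alpha>" "0 \<le> C"
    "\<And>s x \<tau>. \<lbrakk>s \<in> {t..t+\<delta>}; x \<in> ball a \<delta>; \<tau> \<in> {0..\<delta>}\<rbrakk> \<Longrightarrow>
       dist (\<Phi> (s + \<tau> / 2) (\<Psi> s x \<tau>) \<tau>) (\<Psi> (s + \<tau> / 2) (\<Phi> s x \<tau>) \<tau>) \<le> C * \<tau> * \<tau> powr \<alpha>"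
proof -
  obtain \<alpha> C and P :: "'a \<Rightarrow> 'a \<Rightarrow> real \<Rightarrow> real" and r \<epsilon> T where rl: "0 < r" "\<epsilon> \<in> {0<..1}" "t < T" "\<alpha> \<in> {0<..<1}" "0 < C"
    and le: "\<forall>b1\<in>ball a r. \<forall>b2\<in>ball a r. \<forall>h\<in>{0..\<epsilon>}. \<forall>s\<in>{t..T}.
             2 * h \<le> 1 \<and> s + h \<in> {t..T} \<longrightarrow>
             dist (\<Phi> (s + h) (\<Psi> s b1 (2 * h)) (2 * h)) (\<Psi> (s + h) (\<Phi> s b2 (2 * h)) (2 * h))
               \<le> dist b1 b2 * (1 + h * P b1 b2 h) + C * h powr (1 + \<alpha>)"
    by (insert assms(1)[unfolded condition_D_def], elim bexE exE conjE, drule spec[of _ a], drule spec[of _ t],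
        drule mp[OF _ assms(2)], elim exE bexE conjE, rule that)
  \<comment> \<open>\<open>(T - t) / 2\<close> leaves room for the late clock
    \<open>s + \<tau> / 2\<close>.\<close>
  define \<delta> where "\<delta> = Min {r, \<epsilon>, (T - t) / 2}"
  have "0 < \<delta>" using rl by (auto simp: \<delta>_def)
  have \<delta>: "\<delta> \<le> r" "\<delta> \<le> \<epsilon>" "\<delta> \<le> (T - t) / 2" unfolding \<delta>_def by (rule Min_le; simp)+
  have "dist (\<Phi> (s + \<tau> / 2) (\<Psi> s x \<tau>) \<tau>) (\<Psi> (s + \<tau> / 2) (\<Phi> s x \<tau>) \<tau>) \<le> C * \<tau> * \<tau> powr \<alpha>"
    if "s \<in> {t..t+\<delta>}" "x \<in> ball a \<delta>" "\<tau> \<in> {0..\<delta>}" for s x \<tau>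
  proof -
    have "\<tau> \<le> 1" using that \<delta> rl by auto
    \<comment> \<open>With both start points equal to \<open>x\<close>, the factor
      \<open>dist b1 b2\<close> vanishes and only the term in \<open>C\<close> remains.\<close>
    then have "dist (\<Phi> (s + \<tau> / 2) (\<Psi> s x \<tau>) \<tau>) (\<Psi> (s + \<tau> / 2) (\<Phi> s x \<tau>) \<tau>) \<le> C * (\<tau> / 2) powr (1 + \<alpha>)"
      using le[rule_format, of x x "\<tau> / 2" s] that \<delta> \<open>0 < \<delta>\<close> by simp
    also have "\<dots> \<le> C * \<tau> powr (1 + \<alpha>)"
      using that rl by (intro mult_left_mono powr_mono2) auto
    also have "\<dots> = C * \<tau> * \<tau> powr \<alpha>" using that by (simp add: powr_add)
    finally show ?thesis .
  qed
  then show ?thesis using that[of \<delta> \<alpha> C] \<open>0 < \<delta>\<close> rl by simp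
qed

section \<open>Common constants for both arc fields, and the conclusion\<close>

lemma local_arc_mono:
  assumes "local_arc \<Phi> a t \<delta> M \<alpha> v" "0 < \<delta>'" "\<delta>' \<le> \<delta>" "M \<le> M'" "0 < \<alpha>'" "\<alpha>' \<le> \<alpha>"
    "\<And>i. v i \<le> v' i" "summable v'"
  shows "local_arc \<Phi> a t \<delta>' M' \<alpha>' v'"
proof -
  interpret local_arc \<Phi> a t \<delta> M \<alpha> v by fact
  have T: "s \<in> {t..t+\<delta>}" if "s \<in> {t..t+\<delta>'}" for s using that assms(3) by auto
  have B: "x \<in> ball a \<delta>" if "x \<in> ball a \<delta>'" for x using that assms(3) by auto
  have h: "h \<in> {0..\<delta>}" if "h \<in> {0..\<delta>'}" for h using that assms(3) by auto
  show ?thesis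
  proof
    show "0 < \<delta>'" "\<delta>' \<le> 1" "0 \<le> M'" "0 < \<alpha>'" "summable v'" using assms \<delta> M by auto
    show "0 \<le> v' i" for i using assms(7)[of i] v(1)[of i] by linarith
    show "\<Phi> s x 0 = x" if "s \<in> {t..t+\<delta>'}" for s x using at_0 T that by blast
    show "dist (\<Phi> s x h) (\<Phi> s x k) \<le> M' * \<bar>h - k\<bar>"
      if "s \<in> {t..t+\<delta>'}" "x \<in> ball a \<delta>'" "h \<in> {0..\<delta>'}" "k \<in> {0..\<delta>'}" for s x h k
      using speed[OF T B h h, OF that] mult_right_mono[OF assms(4), of "\<bar>h - k\<bar>"] by linarith
    show "dist (\<Phi> s x k) (\<Phi> s y k) \<le> (1 + M' * k) * dist x y"
      if "s \<in> {t..t+\<delta>'}" "x \<in> ball a \<delta>'" "y \<in> ball a \<delta>'" "k \<in> {0..\<delta>'}" for s x y k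
    proof -
      have "(1 + M * k) * dist x y \<le> (1 + M' * k) * dist x y"
        using that assms(4) by (intro mult_right_mono add_left_mono) auto
      then show ?thesis using lipschitz[OF T B B h, OF that] by linarith
    qed
    show "dist (\<Phi> s x (2 * (1/2)^i)) (\<Phi> s (\<Phi> s x ((1/2)^i)) ((1/2)^i)) \<le> (1/2)^i * v' i"
      if "s \<in> {t..t+\<delta>'}" "x \<in> ball a \<delta>'" "(1/2)^i \<le> \<delta>'" for s x i
    proof -
      have "(1/2)^i \<le> \<delta>" using that(3) assms(3) by linarith
      then have "dist (\<Phi> s x (2 * (1/2)^i)) (\<Phi> s (\<Phi> s x ((1/2)^i)) ((1/2)^i)) \<le> (1/2)^i * v i"
        using semigroup_dyadic T B that(1,2) by blast
      also have "\<dots> \<le> (1/2)^i * v' i" using assms(7) by (intro mult_left_mono) auto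
      finally show ?thesis .
    qed
    show "\<exists>\<eta>>0. \<forall>s\<in>{t..t+\<delta>'}. \<forall>x\<in>ball a \<delta>'. \<forall>l\<in>{0..<\<eta>}. \<forall>h\<in>{0..<\<eta>}.
       dist (\<Phi> s x (l + h)) (\<Phi> s (\<Phi> s x l) h) \<le> e * h" if "0 < e" for e
      using semigroup_small[OF that] T B by meson
    show "dist (\<Phi> s x k) (\<Phi> s' x k) \<le> M' * k * \<bar>s - s'\<bar> powr \<alpha>'"
      if "s \<in> {t..t+\<delta>'}" "s' \<in> {t..t+\<delta>'}" "x \<in> ball a \<delta>'" "k \<in> {0..\<delta>'}" for s s' x k
    proof -
      \<comment> \<open>Powers of numbers in the unit interval grow when the exponent is lowered, so
        different Hoelder exponents can be replaced by their minimum.\<close>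
      have "\<bar>s - s'\<bar> \<le> 1" using that assms(3) \<delta> by auto
      then have "\<bar>s - s'\<bar> powr \<alpha> \<le> \<bar>s - s'\<bar> powr \<alpha>'" using assms(5,6) by (intro powr_mono') auto
      then have "M * k * \<bar>s - s'\<bar> powr \<alpha> \<le> M' * k * \<bar>s - s'\<bar> powr \<alpha>'"
        using that assms(4) M by (intro mult_mono) auto
      then show ?thesis using hoelder[OF T T B h, OF that] by linarith
    qed
  qed
qed

lemma local_arc_exists:
  fixes \<Phi> :: "('a::metric_space) arc_map"
  assumes "time_dependent_arc_field \<Phi>" "condition_A \<Phi>" "condition_B \<Phi>" "condition_C \<Phi>" "0 \<le> t"
  obtains \<delta> M \<alpha> v where "local_arc \<Phi> a t \<delta> M \<alpha> v"
proof -
  obtain \<delta>1 M1 where 1: "0 < \<delta>1" "0 \<le> M1"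
    "\<And>s x h k. \<lbrakk>s \<in> {t..t+\<delta>1}; x \<in> ball a \<delta>1; h \<in> {0..1}; k \<in> {0..1}\<rbrakk> \<Longrightarrow> dist (\<Phi> s x h) (\<Phi> s x k) \<le> M1 * \<bar>h - k\<bar>"
    using arc_field_speed[OF assms(1,5), of a] by metis
  obtain \<delta>2 M2 where 2: "0 < \<delta>2" "0 \<le> M2"
    "\<And>s x y h. \<lbrakk>s \<in> {t..t+\<delta>2}; x \<in> ball a \<delta>2; y \<in> ball a \<delta>2; h \<in> {0..\<delta>2}\<rbrakk>
      \<Longrightarrow> dist (\<Phi> s x h) (\<Phi> s y h) \<le> (1 + M2 * h) * dist x y"
    using condition_A_local[OF assms(2,5), of a] by metis
  obtain \<delta>3 v where 3: "0 < \<delta>3" "\<And>i::nat. 0 \<le> v i" "summable v"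
    "\<And>s x i. \<lbrakk>s \<in> {t..t+\<delta>3}; x \<in> ball a \<delta>3; (1/2)^i \<le> \<delta>3\<rbrakk>
       \<Longrightarrow> dist (\<Phi> s x (2 * (1/2)^i)) (\<Phi> s (\<Phi> s x ((1/2)^i)) ((1/2)^i)) \<le> (1/2)^i * v i"
    "\<And>e. 0 < e \<Longrightarrow> \<exists>\<eta>>0. \<forall>s\<in>{t..t+\<delta>3}. \<forall>x\<in>ball a \<delta>3. \<forall>l\<in>{0..<\<eta>}. \<forall>h\<in>{0..<\<eta>}.
       dist (\<Phi> s x (l + h)) (\<Phi> s (\<Phi> s x l) h) \<le> e * h"
    using condition_B_local[OF assms(3,1,5), of a] by metis
  obtain \<delta>4 \<alpha> C where 4: "0 < \<delta>4" "0 < \<alpha>" "0 \<le> C"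
    "\<And>s s' x h. \<lbrakk>s \<in> {t..t+\<delta>4}; s' \<in> {t..t+\<delta>4}; x \<in> ball a \<delta>4; h \<in> {0..\<delta>4}\<rbrakk>
       \<Longrightarrow> dist (\<Phi> s x h) (\<Phi> s' x h) \<le> C * h * \<bar>s - s'\<bar> powr \<alpha>"
    using condition_C_local[OF assms(4,5), of a] by metis
  define \<delta> where "\<delta> = Min {1, \<delta>1, \<delta>2, \<delta>3, \<delta>4}"
  define M where "M = M1 + M2 + C"
  have "0 < \<delta>" using 1 2 3 4 by (auto simp: \<delta>_def)
  have \<delta>: "\<delta> \<le> 1" "\<delta> \<le> \<delta>1" "\<delta> \<le> \<delta>2" "\<delta> \<le> \<delta>3" "\<delta> \<le> \<delta>4" unfolding \<delta>_def by (rule Min_le; simp)+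
  have M: "0 \<le> M" "M1 \<le> M" "M2 \<le> M" "C \<le> M" using 1 2 4 by (auto simp: M_def)
  have T: "s \<in> {t..t+\<delta>3}" if "s \<in> {t..t+\<delta>}" for s using that \<delta> by auto
  have B: "x \<in> ball a \<delta>3" if "x \<in> ball a \<delta>" for x using that \<delta> by auto
  have "local_arc \<Phi> a t \<delta> M \<alpha> v"
  proof
    show "0 < \<delta>" "\<delta> \<le> 1" "0 \<le> M" "0 < \<alpha>" "summable v" by fact+
    show "0 \<le> v i" for i by fact
    show "\<Phi> s x 0 = x" if "s \<in> {t..t+\<delta>}" for s x
      using assms(1,5) that unfolding time_dependent_arc_field_def by auto
    show "dist (\<Phi> s x h) (\<Phi> s x k) \<le> M * \<bar>h - k\<bar>"
      if "s \<in> {t..t+\<delta>}" "x \<in> ball a \<delta>" "h \<in> {0..\<delta>}" "k \<in> {0..\<delta>}" for s x h k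
    proof -
      have "dist (\<Phi> s x h) (\<Phi> s x k) \<le> M1 * \<bar>h - k\<bar>" using that \<delta> by (intro 1(3)) auto
      then show ?thesis using mult_right_mono[OF M(2), of "\<bar>h - k\<bar>"] by linarith
    qed
    show "dist (\<Phi> s x k) (\<Phi> s y k) \<le> (1 + M * k) * dist x y"
      if "s \<in> {t..t+\<delta>}" "x \<in> ball a \<delta>" "y \<in> ball a \<delta>" "k \<in> {0..\<delta>}" for s x y k
    proof -
      have "dist (\<Phi> s x k) (\<Phi> s y k) \<le> (1 + M2 * k) * dist x y" using that \<delta> by (intro 2(3)) auto
      also have "\<dots> \<le> (1 + M * k) * dist x y"
        using that M by (intro mult_right_mono add_left_mono) auto
      finally show ?thesis .
    qed
    show "dist (\<Phi> s x (2 * (1/2)^i)) (\<Phi> s (\<Phi> s x ((1/2)^i)) ((1/2)^i)) \<le> (1/2)^i * v i"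
      if "s \<in> {t..t+\<delta>}" "x \<in> ball a \<delta>" "(1/2)^i \<le> \<delta>" for s x i
    proof -
      have "(1/2)^i \<le> \<delta>3" using that(3) \<delta>(4) by linarith
      then show ?thesis using 3(4) T B that(1,2) by blast
    qed
    show "\<exists>\<eta>>0. \<forall>s\<in>{t..t+\<delta>}. \<forall>x\<in>ball a \<delta>. \<forall>l\<in>{0..<\<eta>}. \<forall>h\<in>{0..<\<eta>}.
       dist (\<Phi> s x (l + h)) (\<Phi> s (\<Phi> s x l) h) \<le> e * h" if "0 < e" for e
      using 3(5)[OF that] T B by meson
    show "dist (\<Phi> s x k) (\<Phi> s' x k) \<le> M * k * \<bar>s - s'\<bar> powr \<alpha>"
      if "s \<in> {t..t+\<delta>}" "s' \<in> {t..t+\<delta>}" "x \<in> ball a \<delta>" "k \<in> {0..\<delta>}" for s s' x k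
    proof -
      have "dist (\<Phi> s x k) (\<Phi> s' x k) \<le> C * k * \<bar>s - s'\<bar> powr \<alpha>" using that \<delta> by (intro 4(4)) auto
      also have "\<dots> \<le> M * k * \<bar>s - s'\<bar> powr \<alpha>"
        using that M by (intro mult_right_mono) auto
      finally show ?thesis .
    qed
  qed
  then show ?thesis using that by blast
qed

theorem theorem3p6:
  fixes \<Phi> \<Psi> :: "('a::metric_space) arc_map"
  assumes "\<forall>x::'a. \<exists>U. x \<in> interior U \<and> complete U"
    and "time_dependent_arc_field \<Phi>" and "time_dependent_arc_field \<Psi>"
    and "condition_A \<Phi>" and "condition_B \<Phi>" and "condition_C \<Phi>"
    and "condition_A \<Psi>" and "condition_B \<Psi>" and "condition_C \<Psi>"
    and "condition_D \<Phi> \<Psi>"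
  shows "\<forall>a. \<forall>t\<ge>0. \<exists>c>0. \<exists>\<sigma>. sum_solution_curve \<Phi> \<Psi> a t c \<sigma>"
proof (intro allI impI)
  fix a :: 'a and t :: real assume t: "0 \<le> t"
  obtain \<delta>1 M1 \<alpha>1 v1 where 1: "local_arc \<Phi> a t \<delta>1 M1 \<alpha>1 v1"
    using local_arc_exists[OF assms(2,4-6) t, of a] by metis
  obtain \<delta>2 M2 \<alpha>2 v2 where 2: "local_arc \<Psi> a t \<delta>2 M2 \<alpha>2 v2"
    using local_arc_exists[OF assms(3,7-9) t, of a] by metis
  obtain \<delta>3 \<alpha>3 C where 3: "0 < \<delta>3" "0 < \<alpha>3" "0 \<le> C"
    "\<And>s x \<tau>. \<lbrakk>s \<in> {t..t+\<delta>3}; x \<in> ball a \<delta>3; \<tau> \<in> {0..\<delta>3}\<rbrakk> \<Longrightarrow>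
       dist (\<Phi> (s + \<tau> / 2) (\<Psi> s x \<tau>) \<tau>) (\<Psi> (s + \<tau> / 2) (\<Phi> s x \<tau>) \<tau>) \<le> C * \<tau> * \<tau> powr \<alpha>3"
    using condition_D_local[OF assms(10) t, of a] by metis
  obtain U r where U: "complete U" "0 < r" "ball a r \<subseteq> U"
    using assms(1) by (meson interior_subset mem_interior)
  note l1 = local_arc.\<delta>[OF 1] local_arc.M[OF 1] local_arc.\<alpha>[OF 1] local_arc.v[OF 1]
  note l2 = local_arc.\<delta>[OF 2] local_arc.M[OF 2] local_arc.\<alpha>[OF 2] local_arc.v[OF 2]
  define \<delta> where "\<delta> = Min {\<delta>1, \<delta>2, \<delta>3, r}"
  define M where "M = M1 + M2 + C"
  define \<alpha> where "\<alpha> = Min {\<alpha>1, \<alpha>2, \<alpha>3}"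
  define v where "v i = v1 i + v2 i" for i
  have pos: "0 < \<delta>" "0 < \<alpha>" using l1 l2 3 U by (auto simp: \<delta>_def \<alpha>_def)
  have \<delta>: "\<delta> \<le> \<delta>1" "\<delta> \<le> \<delta>2" "\<delta> \<le> \<delta>3" "\<delta> \<le> r" unfolding \<delta>_def by (rule Min_le; simp)+
  have \<alpha>: "\<alpha> \<le> \<alpha>1" "\<alpha> \<le> \<alpha>2" "\<alpha> \<le> \<alpha>3" unfolding \<alpha>_def by (rule Min_le; simp)+
  have M: "M1 \<le> M" "M2 \<le> M" "C \<le> M" using l1 l2 3 by (auto simp: M_def)
  have v: "v1 i \<le> v i" "v2 i \<le> v i" for i using l1 l2 by (auto simp: v_def)
  have sv: "summable v" unfolding v_def using l1 l2 by (intro summable_add) auto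
  interpret Phi: local_arc \<Phi> a t \<delta> M \<alpha> v
    using local_arc_mono[OF 1 pos(1) \<delta>(1) M(1) pos(2) \<alpha>(1) v(1) sv] .
  interpret Psi: local_arc \<Psi> a t \<delta> M \<alpha> v
    using local_arc_mono[OF 2 pos(1) \<delta>(2) M(2) pos(2) \<alpha>(2) v(2) sv] .
  interpret arc_pair \<Phi> \<Psi> a t \<delta> M \<alpha> v
  proof
    fix s x \<tau> assume z: "s \<in> {t..t+\<delta>}" "x \<in> ball a \<delta>" "\<tau> \<in> {0..\<delta>}"
    have "dist (\<Phi> (s + \<tau> / 2) (\<Psi> s x \<tau>) \<tau>) (\<Psi> (s + \<tau> / 2) (\<Phi> s x \<tau>) \<tau>) \<le> C * \<tau> * \<tau> powr \<alpha>3"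
      using z \<delta> by (intro 3(4)) auto
    also have "\<dots> \<le> M * \<tau> * \<tau> powr \<alpha>"
      using z M 3(3) \<alpha> pos Phi.\<delta>(2) Phi.M by (intro mult_mono powr_mono') auto
    finally show "dist (\<Phi> (s + \<tau> / 2) (\<Psi> s x \<tau>) \<tau>) (\<Psi> (s + \<tau> / 2) (\<Phi> s x \<tau>) \<tau>) \<le> M * \<tau> * \<tau> powr \<alpha>" .
  qed
  have "ball a \<delta> \<subseteq> U" using U(3) \<delta>(4) by auto
  from scheme[OF U(1) this]
  interpret E: evolution_scheme G a t D "(2 + M) * M" "(2 + M) * M"
    "\<lambda>i. (2 + M) * v i + 5 * M * (1 + M)^2 * ((1/2)^i) powr \<alpha>" U .
  have "((\<lambda>h. dist (E.\<sigma> (s + 2 * h)) (\<Psi> (s + h) (\<Phi> s (E.\<sigma> s) (2 * h)) (2 * h)) / (2 * h)) \<longlongrightarrow> 0) (at_right 0)"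
    if s: "s \<in> {t..<t + E.c}" for s
  proof (rule tendstoI)
    fix e :: real assume "0 < e"
    then obtain \<eta> where \<eta>: "0 < \<eta>" "\<And>h. h \<in> {0<..<\<eta>} \<Longrightarrow> dist (E.\<sigma> (s + h)) (G s h (E.\<sigma> s)) \<le> e / 2 * h"
      using E.\<sigma>_tangent[OF s, of "e / 2"] by auto
    have "dist (dist (E.\<sigma> (s + 2 * h)) (\<Psi> (s + h) (\<Phi> s (E.\<sigma> s) (2 * h)) (2 * h)) / (2 * h)) 0 < e"
      if h: "0 < h" "h < \<eta> / 2" for h
    proof -
      have "dist (E.\<sigma> (s + 2 * h)) (\<Psi> (s + h) (\<Phi> s (E.\<sigma> s) (2 * h)) (2 * h)) \<le> e / 2 * (2 * h)"
        using \<eta>(2)[of "2 * h"] h by (simp add: G_def)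
      then have "dist (E.\<sigma> (s + 2 * h)) (\<Psi> (s + h) (\<Phi> s (E.\<sigma> s) (2 * h)) (2 * h)) / (2 * h) \<le> e / 2"
        using h by (simp add: divide_le_eq)
      then show ?thesis using h \<open>0 < e\<close> by simp
    qed
    then show "\<forall>\<^sub>F h in at_right 0.
      dist (dist (E.\<sigma> (s + 2 * h)) (\<Psi> (s + h) (\<Phi> s (E.\<sigma> s) (2 * h)) (2 * h)) / (2 * h)) 0 < e"
      unfolding eventually_at_right_field using \<eta>(1) by (intro exI[of _ "\<eta> / 2"]) auto
  qed
  then show "\<exists>c>0. \<exists>\<sigma>. sum_solution_curve \<Phi> \<Psi> a t c \<sigma>"
    using E.c(1) E.\<sigma>_start unfolding sum_solution_curve_def by blast
qed

end
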